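(* Let $q \geq 4$ be a prime power and $n = q^{2}-1$. Then for every integer $i$ with $1 \leq i \leq q-3$ there exists a convolutional code with parameters $(n,\; n-2(q+i),\; 2(q-2-i);\; 1,\; d_{free} \geq 2q+1)_{q}$.
   Context: A matrix $G(D)=(g_{ij})\in \mathbb{F}_q[D]^{k\times n}$ is called basic if it has a polynomial right inverse. Its $i$-th row degree is $\gamma_i=\max_{1\le j\le n}\deg g_{ij}$ and its overall constraint length is $\gamma=\sum_{i=1}^k\gamma_i$. A basic generator matrix of a code is called reduced if its overall constraint length is the smallest among all basic generator matrices of that code. A convolutional code with parameters $(n,k,\gamma;\mu,d_f)_q$ is a submodule $C=\{\mathbf{u}(D)G(D) : \mathbf{u}(D)\in\mathbb{F}_q[D]^k\}$ of $\mathbb{F}_q[D]^n$ generated by a reduced basic matrix $G(D)\in\mathbb{F}_q[D]^{k\times n}$, where $n$ is the length, $k$ the dimension, $\gamma=\sum_{i=1}^k\gamma_i$ the degree, $\mu=\max_{1\le i\le k}\gamma_i$ the memory, and $d_f=d_{free}=\min\{\mathrm{wt}(\mathbf{v}(D)) : \mathbf{v}(D)\in C,\ \mathbf{v}(D)\neq 0\}$ the free distance; here $\mathrm{wt}(\mathbf{v}(D))$ is the total number of nonzero coefficients over all $n$ polynomial components of $\mathbf{v}(D)$. Writing "$d_{free}\ge a$" in the last slot means the free distance is at least $a$. *)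

theory Defs
  imports
    "Jordan_Normal_Form.Matrix"
    "HOL-Computational_Algebra.Polynomial"
    "HOL-Number_Theory.Prime_Powers"
    "HOL-Library.Cardinality"
begin

definition basic_mat :: "'a::field poly mat \<Rightarrow> bool" where
  "basic_mat G \<longleftrightarrow> (\<exists>H \<in> carrier_mat (dim_col G) (dim_row G). G * H = 1\<^sub>m (dim_row G))"

text \<open>The library sets \<open>degree 0 = 0\<close>. Since a basic matrix has no zero row, reading the degree
  of the zero polynomial as minus infinity would give the same row degrees.\<close>

definition row_degree :: "'a::field poly mat \<Rightarrow> nat \<Rightarrow> nat" where
  "row_degree G i = Max ((\<lambda>j. degree (G $$ (i, j))) ` {..<dim_col G})"

definition overall_constraint_length :: "'a::field poly mat \<Rightarrow> nat" where
  "overall_constraint_length G = (\<Sum>i<dim_row G. row_degree G i)"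

definition memory :: "'a::field poly mat \<Rightarrow> nat" where
  "memory G = Max (row_degree G ` {..<dim_row G})"

text \<open>The library's vectors are column vectors, so the row vector \<open>u G\<close> is written as the
  product of the transpose of \<open>G\<close> with \<open>u\<close>.\<close>

definition generated_code :: "'a::field poly mat \<Rightarrow> 'a poly vec set" where
  "generated_code G = {transpose_mat G *\<^sub>v u | u. u \<in> carrier_vec (dim_row G)}"

definition reduced_mat :: "'a::field poly mat \<Rightarrow> bool" where
  "reduced_mat G \<longleftrightarrow> basic_mat G \<and>
     (\<forall>G'. basic_mat G' \<and> generated_code G' = generated_code G \<longrightarrow>
        overall_constraint_length G \<le> overall_constraint_length G')"

definition weight :: "'a::field poly vec \<Rightarrow> nat" where
  "weight v = (\<Sum>j<dim_vec v. card {m. coeff (v $ j) m \<noteq> 0})"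

text \<open>An infimum of natural numbers, hence the minimum whenever the code is nonzero.\<close>

definition free_distance :: "'a::field poly vec set \<Rightarrow> nat" where
  "free_distance C = Inf {weight v | v. v \<in> C \<and> v \<noteq> 0\<^sub>v (dim_vec v)}"

text \<open>\<open>convolutional_code C n k \<gamma> \<mu>\<close>: the set \<open>C\<close> is a convolutional code of length \<open>n\<close>,
  dimension \<open>k\<close>, degree \<open>\<gamma>\<close> and memory \<open>\<mu>\<close>.\<close>

definition convolutional_code ::
  "'a::field poly vec set \<Rightarrow> nat \<Rightarrow> nat \<Rightarrow> nat \<Rightarrow> nat \<Rightarrow> bool" where
  "convolutional_code C n k \<gamma> \<mu> \<longleftrightarrow>
     (\<exists>G \<in> carrier_mat k n. reduced_mat G \<and> C = generated_code G \<and>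
        overall_constraint_length G = \<gamma> \<and> memory G = \<mu>)"

end

theory Submission
  imports "HOL-Algebra.Algebraic_Closure_Type" "HOL-Number_Theory.Residues" Defs
begin

text \<open>Take words \<open>K\<close>, \<open>c\<close>, \<open>a\<close>, linearly independent over the base field, and generate the code by
  the rows \<open>K\<^sub>i\<close> and \<open>c\<^sub>j + D a\<^sub>j\<close>. A constant right inverse exists, and counting constant
  codewords shows that the encoder is reduced. The first nonzero coefficient of a codeword lies in
  the span of \<open>K\<close> and \<open>c\<close>, the last one in the span of \<open>K\<close> and \<open>a\<close>, and a codeword
  with a single nonzero coefficient has it in the span of \<open>K\<close>.

  The words are indexed by the \<open>n\<close>-th roots of unity \<open>x\<close>, the nonzero elements of the field with
  \<open>q\<^sup>2\<close> elements. The span of \<open>K\<close> and \<open>c\<close> has power sums \<open>\<Sum> c\<^sub>x x\<^sup>t\<close> vanishing for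
  \<open>1 \<le> t \<le> q + 1 + i\<close>, the span of \<open>K\<close> and \<open>a\<close> for \<open>q + 2 + i \<le> t \<le> 2q - 1\<close>, so the
  BCH bound yields weights at least \<open>q + 2 + i\<close> and \<open>q - 1 - i\<close>; on the span of \<open>K\<close> the power sums
  vanish for \<open>1 \<le> t \<le> 2q\<close>. The exponents \<open>q\<close> and \<open>2q\<close> come for free from \<open>1\<close> and
  \<open>2\<close> by the Frobenius map. Counting bounds the dimensions of these codes from below; the words \<open>a\<close>
  are traces of \<open>\<lambda> x\<^sup>-\<^sup>m\<close> with \<open>1 \<le> m \<le> q - 2 - i\<close>, which the power sums with exponents
  \<open>1, \<dots>, q - 2 - i\<close> separate from the first code.\<close>

hide_const (open) Polynomials.degree Module.smult Divisibility.prime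

section \<open>Unit memory encoders\<close>

definition word_weight :: "nat \<Rightarrow> (nat \<Rightarrow> 'a::zero) \<Rightarrow> nat" where
  "word_weight n x = card {j. j < n \<and> x j \<noteq> 0}"

lemma row_degree_le_iff:
  assumes "dim_col G > 0"
  shows "row_degree G i \<le> d \<longleftrightarrow> (\<forall>j<dim_col G. degree (G $$ (i, j)) \<le> d)"
  unfolding row_degree_def using assms by (subst Max_le_iff) auto

lemma generated_code_nth:
  assumes "j < dim_col G" "u \<in> carrier_vec (dim_row G)"
  shows "(transpose_mat G *\<^sub>v u) $ j = (\<Sum>s<dim_row G. G $$ (s, j) * u $ s)"
  using assms by (auto simp: scalar_prod_def row_def lessThan_atLeast0 intro!: sum.cong)

text \<open>This is \<open>(u G) H = u (G H) = u\<close> in coordinates: a right inverse recovers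
  the message from its codeword.\<close>

lemma right_inverse_recovers:
  fixes G :: "'a::comm_ring_1 mat"
  assumes H: "H \<in> carrier_mat (dim_col G) (dim_row G)" "G * H = 1\<^sub>m (dim_row G)"
    and u: "u \<in> carrier_vec (dim_row G)" and t: "t < dim_row G"
  shows "(\<Sum>j<dim_col G. (transpose_mat G *\<^sub>v u) $ j * H $$ (j, t)) = u $ t"
proof -
  have GH: "(\<Sum>j<dim_col G. G $$ (s, j) * H $$ (j, t)) = (if s = t then 1 else 0)"
    if "s < dim_row G" for s
  proof -
    have "(G * H) $$ (s, t) = (if s = t then 1 else 0)" using H that t by simp
    also have "(G * H) $$ (s, t) = (\<Sum>j<dim_col G. G $$ (s, j) * H $$ (j, t))"
      using H(1) that t by (auto simp: scalar_prod_def lessThan_atLeast0 intro!: sum.cong)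
    finally show ?thesis .
  qed
  have "(\<Sum>j<dim_col G. (transpose_mat G *\<^sub>v u) $ j * H $$ (j, t)) =
      (\<Sum>j<dim_col G. \<Sum>s<dim_row G. u $ s * (G $$ (s, j) * H $$ (j, t)))"
    by (simp add: generated_code_nth u sum_distrib_right sum_distrib_left mult_ac del: index_mult_mat_vec)
  also have "\<dots> = (\<Sum>s<dim_row G. u $ s * (\<Sum>j<dim_col G. G $$ (s, j) * H $$ (j, t)))"
    by (subst sum.swap) (simp add: sum_distrib_left)
  also have "\<dots> = (\<Sum>s<dim_row G. u $ s * (if s = t then 1 else 0))"
    by (intro sum.cong refl) (simp add: GH)
  also have "\<dots> = u $ t" using t by (simp add: if_distrib cong: if_cong)
  finally show ?thesis .
qed

lemma finite_field_card_gt_1: "CARD('a::{field,finite}) > 1"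
proof -
  have "card {0, 1 :: 'a} \<le> CARD('a)" by (rule card_mono) auto
  thus ?thesis by simp
qed

text \<open>Counting replaces a rank argument: \<open>f\<close> depends only on the restriction of
  its argument to \<open>S\<close>, so it takes at most \<open>CARD('a) ^ card S\<close> values, yet
  every function on \<open>T\<close> occurs.\<close>

lemma card_le_of_fun_surj:
  fixes f :: "('b \<Rightarrow> 'a::{field,finite}) \<Rightarrow> ('c \<Rightarrow> 'a)"
  assumes "finite S" "finite T"
    and surj: "\<And>y. y \<in> T \<rightarrow>\<^sub>E UNIV \<Longrightarrow> \<exists>x. y = f x"
    and f: "\<And>x. f x = f (restrict x S)"
  shows "card T \<le> card S"
proof -
  have "T \<rightarrow>\<^sub>E UNIV \<subseteq> f ` (S \<rightarrow>\<^sub>E UNIV)"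
    using surj f by (metis (no_types, lifting) UNIV_I image_eqI restrict_PiE_iff subsetI)
  hence "card (T \<rightarrow>\<^sub>E (UNIV :: 'a set)) \<le> card (S \<rightarrow>\<^sub>E (UNIV :: 'a set))"
    using assms by (intro surj_card_le) (auto intro!: finite_PiE)
  hence "CARD('a) ^ card T \<le> CARD('a) ^ card S"
    using assms by (simp add: card_funcsetE)
  thus ?thesis by (meson power_le_imp_le_exp finite_field_card_gt_1)
qed

text \<open>A component with a nonzero coefficient at a given time adds at least one to the weight,
  and distinct times are counted separately.\<close>

lemma weight_ge_coeff:
  fixes v :: "'a::field poly vec"
  assumes v: "v \<in> carrier_vec n"
  shows "weight v \<ge> word_weight n (\<lambda>j. coeff (v $ j) l)"
    and "l \<noteq> l' \<Longrightarrow> weight v \<ge> word_weight n (\<lambda>j. coeff (v $ j) l) + word_weight n (\<lambda>j. coeff (v $ j) l')"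
proof -
  have fin: "finite {m. coeff p m \<noteq> 0}" for p :: "'a poly"
    by (rule finite_subset[of _ "{..degree p}"]) (auto intro: le_degree)
  have ww: "word_weight n x = (\<Sum>j<n. if x j \<noteq> 0 then 1 else 0)" for x :: "nat \<Rightarrow> 'a"
  proof -
    have "{j. j < n \<and> x j \<noteq> 0} = {..<n} \<inter> {j. x j \<noteq> 0}" by auto
    thus ?thesis unfolding word_weight_def by (simp only:) (simp add: sum.If_cases)
  qed
  have 1: "(if coeff p l \<noteq> 0 then 1 else 0) \<le> card {m. coeff p m \<noteq> 0}" for p :: "'a poly"
    using card_mono[OF fin, of "{l}" p] by auto
  show "weight v \<ge> word_weight n (\<lambda>j. coeff (v $ j) l)"
    unfolding ww weight_def using v by (auto intro!: sum_mono simp: 1)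
  assume ll: "l \<noteq> l'"
  have 2: "(if coeff p l \<noteq> 0 then 1 else 0) + (if coeff p l' \<noteq> 0 then 1 else 0)
      \<le> card {m. coeff p m \<noteq> 0}" for p :: "'a poly"
  proof -
    have "(if coeff p l \<noteq> 0 then 1 else 0) + (if coeff p l' \<noteq> 0 then 1 else 0) =
       card ({l. coeff p l \<noteq> 0} \<inter> {l, l'})"
      using ll by (auto simp: Int_insert_right)
    also have "\<dots> \<le> card {m. coeff p m \<noteq> 0}" by (intro card_mono fin) auto
    finally show ?thesis .
  qed
  show "weight v \<ge> word_weight n (\<lambda>j. coeff (v $ j) l) + word_weight n (\<lambda>j. coeff (v $ j) l')"
    unfolding ww weight_def sum.distrib[symmetric] using v by (auto intro!: sum_mono simp: 2)
qed

text \<open>The first \<open>m\<close> words are the constant rows \<open>K\<close>, the next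
  \<open>g\<close> are the words \<open>c\<close>, the last \<open>g\<close> the words
  \<open>a\<close>. Linear independence is expressed by a dual family \<open>R\<close>, which reads
  off coordinates and whose first \<open>m + g\<close> columns give a right inverse of the
  encoder.\<close>

locale unit_memory_words =
  fixes n m g :: nat and w R :: "nat \<Rightarrow> nat \<Rightarrow> 'a::{field,finite}"
  assumes biorth: "\<And>s t. s < m + 2 * g \<Longrightarrow> t < m + 2 * g \<Longrightarrow>
      (\<Sum>j<n. w s j * R j t) = (if s = t then 1 else 0)"
    and g_pos: "g > 0"
begin

definition encoder :: "'a poly mat" where
  "encoder = mat (m + g) n (\<lambda>(s, j). [:w s j, if s < m then 0 else w (s + g) j:])"

text \<open>The coordinates of the \<open>l\<close>-th coefficient of the codeword with message \<open>u\<close> in terms of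
  the words \<open>w\<close>: the last \<open>g\<close> words come with a delay of one time unit.\<close>

definition coords :: "'a poly vec \<Rightarrow> nat \<Rightarrow> nat \<Rightarrow> 'a" where
  "coords u l s = (if s < m + g then coeff (u $ s) l
     else if l = 0 then 0 else coeff (u $ (s - g)) (l - 1))"

lemma dim_encoder [simp]: "dim_row encoder = m + g" "dim_col encoder = n"
  by (simp_all add: encoder_def)

lemma n_pos: "n > 0"
  using biorth[of 0 0] g_pos by (cases n) auto

lemma combination_coords:
  assumes "t < m + 2 * g"
  shows "(\<Sum>j<n. (\<Sum>s<m + 2 * g. a s * w s j) * R j t) = a t"
proof -
  have "(\<Sum>j<n. (\<Sum>s<m + 2 * g. a s * w s j) * R j t) =
      (\<Sum>s<m + 2 * g. a s * (\<Sum>j<n. w s j * R j t))"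
    by (simp add: sum_distrib_left sum_distrib_right mult_ac) (rule sum.swap)
  also have "\<dots> = (\<Sum>s<m + 2 * g. a s * (if s = t then 1 else 0))"
    by (intro sum.cong refl) (simp add: biorth assms)
  also have "\<dots> = a t" using assms by (simp add: if_distrib cong: if_cong)
  finally show ?thesis .
qed

lemma combination_split:
  "(\<Sum>s<m + 2 * g. f s) = (\<Sum>s<m + g. f s) + (\<Sum>s = m..<m + g. f (s + g) :: 'a)"
proof -
  have "(\<Sum>s<m + 2 * g. f s) = (\<Sum>s<m + g. f s) + (\<Sum>s=m + g..<m + 2 * g. f s)"
    by (subst sum.union_disjoint[symmetric]) (auto intro!: sum.cong)
  also have "(\<Sum>s=m + g..<m + 2 * g. f s) = (\<Sum>s = m..<m + g. f (s + g))"
    using sum.shift_bounds_nat_ivl[of f m g "m + g"] by (simp add: mult_2 add.assoc)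
  finally show ?thesis .
qed

lemma coeff_codeword:
  assumes u: "u \<in> carrier_vec (m + g)" and j: "j < n"
  shows "coeff ((transpose_mat encoder *\<^sub>v u) $ j) l = (\<Sum>s<m + 2 * g. coords u l s * w s j)"
proof -
  have "coeff ((transpose_mat encoder *\<^sub>v u) $ j) l = (\<Sum>s<m + g. coeff (encoder $$ (s, j) * u $ s) l)"
    using u j by (subst generated_code_nth) (simp_all add: coeff_sum)
  also have "\<dots> = (\<Sum>s<m + g. coords u l s * w s j +
       (if s < m then 0 else coords u l (s + g) * w (s + g) j))"
    using j by (intro sum.cong refl)
      (auto simp: encoder_def coords_def coeff_pCons mult_ac split: nat.splits)
  also have "\<dots> = (\<Sum>s<m + g. coords u l s * w s j) +
       (\<Sum>s<m + g. if s < m then 0 else coords u l (s + g) * w (s + g) j)"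
    by (rule sum.distrib)
  also have "(\<Sum>s<m + g. if s < m then 0 else coords u l (s + g) * w (s + g) j) =
      (\<Sum>s=m..<m + g. coords u l (s + g) * w (s + g) j)"
    by (intro sum.mono_neutral_cong_right) auto
  finally show ?thesis by (simp add: combination_split)
qed

lemma coords_eq_0:
  assumes u: "u \<in> carrier_vec (m + g)" and t: "t < m + 2 * g"
    and z: "\<And>j. j < n \<Longrightarrow> coeff ((transpose_mat encoder *\<^sub>v u) $ j) l = 0"
  shows "coords u l t = 0"
proof -
  have "coords u l t = (\<Sum>j<n. (\<Sum>s<m + 2 * g. coords u l s * w s j) * R j t)"
    by (simp add: combination_coords t)
  also have "\<dots> = 0" using z by (simp add: coeff_codeword[OF u, symmetric] del: index_mult_mat_vec)
  finally show ?thesis .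
qed

text \<open>If the preceding coefficient vanishes, so do its coordinates, and these are the ones
  that return one step later on the words \<open>a\<close>. For \<open>l = 0\<close> nothing
  precedes and \<open>z\<close> is vacuous.\<close>

lemma coeff_codeword_first:
  assumes u: "u \<in> carrier_vec (m + g)" and j: "j < n"
    and z: "\<And>j l'. j < n \<Longrightarrow> Suc l' = l \<Longrightarrow> coeff ((transpose_mat encoder *\<^sub>v u) $ j) l' = 0"
  shows "coeff ((transpose_mat encoder *\<^sub>v u) $ j) l = (\<Sum>s<m + g. coords u l s * w s j)"
proof -
  have "coords u l (s + g) = 0" if "s \<in> {m..<m + g}" for s
  proof (cases l)
    case (Suc l')
    have "coords u l' s = 0" using that z Suc by (intro coords_eq_0 u) auto
    thus ?thesis using that Suc by (simp add: coords_def)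
  qed (use that in \<open>simp add: coords_def\<close>)
  thus ?thesis unfolding coeff_codeword[OF u j] combination_split by simp
qed

text \<open>The coordinate on a word \<open>c\<close> at time \<open>l\<close> returns at time
  \<open>l + 1\<close> on the matching word \<open>a\<close>, where independence makes it
  vanish.\<close>

lemma coords_before_zero:
  assumes u: "u \<in> carrier_vec (m + g)" and s: "m \<le> s" "s < m + g"
    and z: "\<And>j. j < n \<Longrightarrow> coeff ((transpose_mat encoder *\<^sub>v u) $ j) (Suc l) = 0"
  shows "coords u l s = 0"
  using coords_eq_0[OF u, of "s + g" "Suc l"] s z by (auto simp: coords_def)

lemma coeff_codeword_last:
  assumes u: "u \<in> carrier_vec (m + g)" and j: "j < n"
    and z: "\<And>j. j < n \<Longrightarrow> coeff ((transpose_mat encoder *\<^sub>v u) $ j) (Suc l) = 0"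
  shows "coeff ((transpose_mat encoder *\<^sub>v u) $ j) l =
      (\<Sum>s\<in>{..<m} \<union> {m + g..<m + 2 * g}. coords u l s * w s j)"
  unfolding coeff_codeword[OF u j]
  by (intro sum.mono_neutral_right) (auto simp: coords_before_zero[OF u _ _ z])

section \<open>The encoder is basic and reduced\<close>

lemma basic_encoder: "basic_mat encoder"
  unfolding basic_mat_def
proof (intro bexI)
  \<comment> \<open>The dual family, read as a matrix of constants.\<close>
  let ?H = "mat n (m + g) (\<lambda>(j, t). [:R j t:])"
  show "?H \<in> carrier_mat (dim_col encoder) (dim_row encoder)" by simp
  show "encoder * ?H = 1\<^sub>m (dim_row encoder)"
  proof (rule eq_matI)
    fix s t assume "s < dim_row (1\<^sub>m (dim_row encoder) :: 'a poly mat)"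
      "t < dim_col (1\<^sub>m (dim_row encoder) :: 'a poly mat)"
    hence st: "s < m + g" "t < m + g" by auto
    have "(encoder * ?H) $$ (s, t) = (\<Sum>j<n. [:w s j, if s < m then 0 else w (s + g) j:] * [:R j t:])"
      using st by (auto simp: encoder_def scalar_prod_def lessThan_atLeast0 intro!: sum.cong)
    also have "\<dots> = [:\<Sum>j<n. w s j * R j t, \<Sum>j<n. (if s < m then 0 else w (s + g) j) * R j t:]"
      by (intro poly_eqI) (auto simp: coeff_sum coeff_pCons mult_ac split: nat.splits)
    also have "(\<Sum>j<n. w s j * R j t) = (if s = t then 1 else 0)" using st by (simp add: biorth)
    \<comment> \<open>For \<open>s \<ge> m\<close> the index \<open>s + g\<close> is at least
      \<open>m + g\<close>, hence differs from \<open>t\<close>, so the dual family kills the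
      coefficient of \<open>D\<close>.\<close>
    also have "(\<Sum>j<n. (if s < m then 0 else w (s + g) j) * R j t) = 0"
      using biorth[of "s + g" t] st by (cases "s < m") auto
    finally show "(encoder * ?H) $$ (s, t) = 1\<^sub>m (dim_row encoder) $$ (s, t)"
      using st by (simp add: one_pCons)
  qed auto
qed

text \<open>Constant terms of codewords realise all choices of the first \<open>m + g\<close>
  coordinates. Through \<open>G'\<close> they depend only on the constant terms of the message,
  which are \<open>dim_row G'\<close> scalars.\<close>

lemma dim_row_ge:
  assumes G': "dim_col G' = n" and sub: "generated_code encoder \<subseteq> generated_code G'"
  shows "m + g \<le> dim_row G'"
proof -
  let ?f = "\<lambda>y :: nat \<Rightarrow> 'a. \<lambda>s\<in>{..<m + g}. \<Sum>j<n. (\<Sum>t<dim_row G'. coeff (G' $$ (t, j)) 0 * y t) * R j s"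
  have "card {..<m + g} \<le> card {..<dim_row G'}"
  proof (rule card_le_of_fun_surj)
    fix x :: "nat \<Rightarrow> 'a" assume x: "x \<in> {..<m + g} \<rightarrow>\<^sub>E UNIV"
    define u where "u = vec (m + g) (\<lambda>s. [:x s:])"
    have u: "u \<in> carrier_vec (m + g)" by (simp add: u_def)
    have "transpose_mat encoder *\<^sub>v u \<in> generated_code G'"
      using sub u by (auto simp: generated_code_def)
    then obtain u' where u': "u' \<in> carrier_vec (dim_row G')"
      and eq: "transpose_mat encoder *\<^sub>v u = transpose_mat G' *\<^sub>v u'"
      by (auto simp: generated_code_def)
    have "(\<Sum>t<dim_row G'. coeff (G' $$ (t, j)) 0 * coeff (u' $ t) 0) =
        (\<Sum>s<m + 2 * g. coords u 0 s * w s j)" if j: "j < n" for j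
    proof -
      have "(\<Sum>t<dim_row G'. coeff (G' $$ (t, j)) 0 * coeff (u' $ t) 0) =
          coeff ((transpose_mat G' *\<^sub>v u') $ j) 0"
        using j u' G' by (subst generated_code_nth) (auto simp: coeff_sum coeff_mult)
      thus ?thesis using coeff_codeword[OF u j, of 0] eq by simp
    qed
    hence "?f (\<lambda>t. coeff (u' $ t) 0) = (\<lambda>s\<in>{..<m + g}. coords u 0 s)"
      by (intro restrict_ext) (simp add: combination_coords)
    also have "\<dots> = x" using x by (auto simp: coords_def u_def fun_eq_iff PiE_iff extensional_def)
    finally have "x = ?f (\<lambda>t. coeff (u' $ t) 0)" by simp
    thus "\<exists>y. x = ?f y" by (rule exI[of _ "\<lambda>t. coeff (u' $ t) 0"])
  qed auto
  thus ?thesis by simp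
qed

text \<open>Constant messages on the constant rows of \<open>G'\<close> yield constant codewords. In
  terms of the encoder these involve only the first \<open>m\<close> words, so \<open>m\<close>
  scalars describe them, and the right inverse of \<open>G'\<close> recovers the messages.\<close>

lemma card_constant_rows_le:
  assumes G': "dim_col G' = n" and basic: "basic_mat G'"
    and sub: "generated_code G' \<subseteq> generated_code encoder"
  shows "card {t. t < dim_row G' \<and> row_degree G' t = 0} \<le> m"
proof -
  obtain H where H: "H \<in> carrier_mat (dim_col G') (dim_row G')" "G' * H = 1\<^sub>m (dim_row G')"
    using basic unfolding basic_mat_def by auto
  define T where "T = {t. t < dim_row G' \<and> row_degree G' t = 0}"
  have const: "degree (G' $$ (t, j)) = 0" if "t \<in> T" "j < n" for t j
    using row_degree_le_iff[of G' t 0] n_pos G' that by (auto simp: T_def)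
  let ?f = "\<lambda>x :: nat \<Rightarrow> 'a. \<lambda>t\<in>T. \<Sum>j<n. (\<Sum>s<m. x s * w s j) * coeff (H $$ (j, t)) 0"
  have "card T \<le> card {..<m}"
  proof (rule card_le_of_fun_surj)
    fix y :: "nat \<Rightarrow> 'a" assume y: "y \<in> T \<rightarrow>\<^sub>E UNIV"
    define u' where "u' = vec (dim_row G') (\<lambda>t. if t \<in> T then [:y t:] else 0)"
    have u': "u' \<in> carrier_vec (dim_row G')" by (simp add: u'_def)
    define v where "v = transpose_mat G' *\<^sub>v u'"
    have "v \<in> generated_code encoder"
      using sub u' by (auto simp: generated_code_def v_def)
    then obtain u where u: "u \<in> carrier_vec (m + g)" and eq: "v = transpose_mat encoder *\<^sub>v u"
      by (auto simp: generated_code_def)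
    have v0: "degree (v $ j) = 0" if j: "j < n" for j
    proof -
      have "degree (\<Sum>t<dim_row G'. G' $$ (t, j) * u' $ t) \<le> 0"
      proof (intro degree_sum_le)
        fix t assume "t \<in> {..<dim_row G'}"
        thus "degree (G' $$ (t, j) * u' $ t) \<le> 0"
          using degree_mult_le[of "G' $$ (t, j)" "u' $ t"] const[of t j] j
          by (cases "t \<in> T") (auto simp: u'_def)
      qed auto
      thus ?thesis using j u' G' unfolding v_def by (subst generated_code_nth) auto
    qed
    \<comment> \<open>The codeword has no coefficient at time 1, so no word \<open>c\<close> can
      occur at time 0.\<close>
    have "coords u 0 s = 0" if "m \<le> s" "s < m + g" for s
      using v0 that by (intro coords_before_zero[OF u]) (auto simp: eq[symmetric] coeff_eq_0)
    hence vc: "coeff (v $ j) 0 = (\<Sum>s<m. coords u 0 s * w s j)" if "j < n" for j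
      unfolding eq coeff_codeword[OF u that]
      by (intro sum.mono_neutral_right) (auto simp: coords_def)
    have "(\<Sum>j<n. (\<Sum>s<m. coords u 0 s * w s j) * coeff (H $$ (j, t)) 0) = y t" if t: "t \<in> T" for t
    proof -
      have "(\<Sum>j<n. (\<Sum>s<m. coords u 0 s * w s j) * coeff (H $$ (j, t)) 0) =
          coeff (\<Sum>j<n. v $ j * H $$ (j, t)) 0"
        by (simp add: coeff_sum coeff_mult vc)
      also have "(\<Sum>j<n. v $ j * H $$ (j, t)) = u' $ t"
        using right_inverse_recovers[OF H u', of t] t G' by (simp add: v_def T_def)
      also have "coeff \<dots> 0 = y t" using t by (auto simp: u'_def T_def)
      finally show ?thesis .
    qed
    hence "?f (coords u 0) = (\<lambda>t\<in>T. y t)" by (intro restrict_ext) auto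
    also have "\<dots> = y" using y by (simp add: PiE_restrict)
    finally have "y = ?f (coords u 0)" by (rule sym)
    thus "\<exists>x. y = ?f x" by (rule exI[of _ "coords u 0"])
  qed (auto simp: T_def)
  thus ?thesis by (simp add: T_def)
qed

lemma row_degree_encoder:
  assumes s: "s < m + g"
  shows "row_degree encoder s = (if s < m then 0 else 1)"
proof (cases "s < m")
  case True
  hence "row_degree encoder s \<le> 0"
    using s n_pos by (subst row_degree_le_iff) (auto simp: encoder_def)
  thus ?thesis using True by simp
next
  case False
  have "row_degree encoder s \<le> 1"
    using s n_pos by (subst row_degree_le_iff) (auto simp: encoder_def)
  moreover have "\<not> row_degree encoder s \<le> 0"
  proof
    assume "row_degree encoder s \<le> 0"
    hence "\<forall>j<n. w (s + g) j = 0"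
      using s False n_pos by (subst (asm) row_degree_le_iff) (auto simp: encoder_def split: if_splits)
    thus False using biorth[of "s + g" "s + g"] s by simp
  qed
  ultimately show ?thesis using False by simp
qed

lemma overall_constraint_length_encoder: "overall_constraint_length encoder = g"
proof -
  have "overall_constraint_length encoder = (\<Sum>s<m + g. if s < m then 0 else 1)"
    unfolding overall_constraint_length_def by (intro sum.cong) (auto simp: row_degree_encoder)
  also have "\<dots> = (\<Sum>s\<in>{m..<m + g}. 1)" by (intro sum.mono_neutral_cong_right) auto
  finally show ?thesis by simp
qed

lemma memory_encoder: "memory encoder = 1"
  unfolding memory_def
proof (rule Max_eqI)
  have "row_degree encoder m = 1" using g_pos by (simp add: row_degree_encoder)
  thus "1 \<in> row_degree encoder ` {..<dim_row encoder}" using g_pos by (intro image_eqI[of _ _ m]) auto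
qed (auto simp: row_degree_encoder)

text \<open>A basic matrix of the same code has at least \<open>m + g\<close> rows, at most
  \<open>m\<close> of them of degree zero; the other rows, at least \<open>g\<close> in number, each
  contribute at least one.\<close>

lemma reduced_encoder: "reduced_mat encoder"
  unfolding reduced_mat_def
proof (intro conjI allI impI basic_encoder, elim conjE)
  fix G' :: "'a poly mat" assume basic: "basic_mat G'" and eq: "generated_code G' = generated_code encoder"
  \<comment> \<open>Vectors carry their length, so the shared zero codeword fixes the number of
    columns of \<open>G'\<close>.\<close>
  have "transpose_mat encoder *\<^sub>v 0\<^sub>v (m + g) \<in> generated_code G'"
    unfolding eq by (auto simp: generated_code_def)
  hence col: "dim_col G' = n" by (auto simp: generated_code_def dest!: arg_cong[where f = dim_vec])
  let ?T = "{t. t < dim_row G' \<and> row_degree G' t = 0}"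
  have "g \<le> dim_row G' - card ?T"
    using dim_row_ge[OF col] card_constant_rows_le[OF col basic] eq by auto
  also have "\<dots> = card ({..<dim_row G'} - ?T)" by (subst card_Diff_subset) auto
  also have "\<dots> = (\<Sum>t\<in>{..<dim_row G'} - ?T. 1)" by simp
  also have "\<dots> \<le> (\<Sum>t\<in>{..<dim_row G'} - ?T. row_degree G' t)"
    by (intro sum_mono) auto
  also have "\<dots> \<le> overall_constraint_length G'"
    unfolding overall_constraint_length_def by (intro sum_mono2) auto
  finally show "overall_constraint_length encoder \<le> overall_constraint_length G'"
    by (simp add: overall_constraint_length_encoder)
qed

lemma convolutional_code_encoder:
  "convolutional_code (generated_code encoder) n (m + g) g 1"
  unfolding convolutional_code_def
  by (intro bexI[of _ encoder])
     (auto simp: reduced_encoder overall_constraint_length_encoder memory_encoder)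

section \<open>The free distance through first and last coefficients\<close>

lemma free_distance_encoder:
  assumes first: "\<And>a j. j < n \<Longrightarrow> (\<Sum>s<m + g. a s * w s j) \<noteq> 0 \<Longrightarrow>
      d_first \<le> word_weight n (\<lambda>j. \<Sum>s<m + g. a s * w s j)"
    and last: "\<And>a j. j < n \<Longrightarrow> (\<Sum>s\<in>{..<m} \<union> {m + g..<m + 2 * g}. a s * w s j) \<noteq> 0 \<Longrightarrow>
      d_last \<le> word_weight n (\<lambda>j. \<Sum>s\<in>{..<m} \<union> {m + g..<m + 2 * g}. a s * w s j)"
    and const: "\<And>a j. j < n \<Longrightarrow> (\<Sum>s<m. a s * w s j) \<noteq> 0 \<Longrightarrow>
      d \<le> word_weight n (\<lambda>j. \<Sum>s<m. a s * w s j)"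
    and d: "d \<le> d_first + d_last"
  shows "d \<le> free_distance (generated_code encoder)"
  unfolding free_distance_def
proof (rule cInf_greatest)
  \<comment> \<open>A unit message supplies a nonzero codeword: lower bounds pass to the infimum
    only over a nonempty set.\<close>
  let ?u = "unit_vec (m + g) 0 :: 'a poly vec"
  have "transpose_mat encoder *\<^sub>v ?u \<noteq> 0\<^sub>v (dim_vec (transpose_mat encoder *\<^sub>v ?u))"
  proof
    assume "transpose_mat encoder *\<^sub>v ?u = 0\<^sub>v (dim_vec (transpose_mat encoder *\<^sub>v ?u))"
    hence "coeff ((transpose_mat encoder *\<^sub>v ?u) $ j) 0 = 0" if "j < n" for j
      using that by (metis coeff_0 dim_encoder(2) dim_mult_mat_vec index_transpose_mat(2) index_zero_vec(1))
    hence "coords ?u 0 0 = 0" using g_pos by (intro coords_eq_0) auto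
    thus False using g_pos by (simp add: coords_def)
  qed
  moreover have "transpose_mat encoder *\<^sub>v ?u \<in> generated_code encoder"
    by (auto simp: generated_code_def)
  ultimately show "{weight v |v. v \<in> generated_code encoder \<and> v \<noteq> 0\<^sub>v (dim_vec v)} \<noteq> {}"
    by blast
  fix x assume "x \<in> {weight v |v. v \<in> generated_code encoder \<and> v \<noteq> 0\<^sub>v (dim_vec v)}"
  then obtain u where u: "u \<in> carrier_vec (m + g)"
    and x: "x = weight (transpose_mat encoder *\<^sub>v u)"
    and nz: "transpose_mat encoder *\<^sub>v u \<noteq> 0\<^sub>v (dim_vec (transpose_mat encoder *\<^sub>v u))"
    by (auto simp: generated_code_def)
  define v where "v = transpose_mat encoder *\<^sub>v u"
  have v: "v \<in> carrier_vec n" by (auto simp: v_def intro!: carrier_vecI)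
  \<comment> \<open>The times at which the codeword is active; its minimum and maximum are the first
    and last coefficients.\<close>
  define L where "L = {l. \<exists>j<n. coeff (v $ j) l \<noteq> 0}"
  have "L = (\<Union>j<n. {l. coeff (v $ j) l \<noteq> 0})" by (auto simp: L_def)
  moreover have "finite {l. coeff p l \<noteq> 0}" for p :: "'a poly"
    by (rule finite_subset[of _ "{..degree p}"]) (auto intro: le_degree)
  ultimately have fin: "finite L" by auto
  have "\<exists>j<n. v $ j \<noteq> 0" using nz v unfolding v_def[symmetric] by (metis carrier_vecD eq_vecI index_zero_vec)
  hence "L \<noteq> {}" by (auto simp: L_def poly_eq_iff)
  define l0 l1 where "l0 = Min L" and "l1 = Max L"
  have mem: "l0 \<in> L" "l1 \<in> L" using fin \<open>L \<noteq> {}\<close> by (auto simp: l0_def l1_def)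
  have le: "l0 \<le> l" "l \<le> l1" if "l \<in> L" for l using fin that by (auto simp: l0_def l1_def)
  have before: "coeff (v $ j) l = 0" if "j < n" "Suc l = l0" for j l
    using le(1)[of l] that by (auto simp: L_def)
  have after: "coeff (v $ j) (Suc l1) = 0" if "j < n" for j
    using le(2)[of "Suc l1"] that by (auto simp: L_def)
  have ww_cong: "word_weight n y = word_weight n z" if "\<And>j. j < n \<Longrightarrow> y j = z j" for y z :: "nat \<Rightarrow> 'a"
    unfolding word_weight_def using that by (intro arg_cong[where f = card]) auto
  have c0: "coeff (v $ j) l0 = (\<Sum>s<m + g. coords u l0 s * w s j)" if "j < n" for j
    unfolding v_def by (rule coeff_codeword_first) (use u that before in \<open>auto simp: v_def\<close>)
  have c1: "coeff (v $ j) l1 = (\<Sum>s\<in>{..<m} \<union> {m + g..<m + 2 * g}. coords u l1 s * w s j)" if "j < n" for j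
    unfolding v_def by (rule coeff_codeword_last) (use u that after in \<open>auto simp: v_def\<close>)
  show "d \<le> x"
  proof (cases "l0 = l1")
    case True
    \<comment> \<open>A single active time is both first and last, so neither words \<open>a\<close>
      nor words \<open>c\<close> occur.\<close>
    have "coeff (v $ j) l0 = (\<Sum>s<m. coords u l0 s * w s j)" if "j < n" for j
      unfolding c0[OF that]
      using after True by (intro sum.mono_neutral_right) (auto simp: v_def intro!: coords_before_zero[OF u])
    hence "d \<le> word_weight n (\<lambda>j. coeff (v $ j) l0)"
      using mem(1) const[of _ "coords u l0"] by (subst ww_cong) (auto simp: L_def)
    also have "\<dots> \<le> x" unfolding x v_def[symmetric] by (rule weight_ge_coeff(1)[OF v])
    finally show ?thesis .
  next
    case False
    have "d_first \<le> word_weight n (\<lambda>j. coeff (v $ j) l0)"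
      using mem(1) c0 first[of _ "coords u l0"] by (subst ww_cong[OF c0]) (auto simp: L_def)
    moreover have "d_last \<le> word_weight n (\<lambda>j. coeff (v $ j) l1)"
      using mem(2) c1 last[of _ "coords u l1"] by (subst ww_cong[OF c1]) (auto simp: L_def)
    ultimately show ?thesis using d weight_ge_coeff(2)[OF v False] unfolding x v_def[symmetric] by linarith
  qed
qed

end

section \<open>Linear algebra over a finite field\<close>

interpretation poly_space: vector_space "smult :: 'a::field \<Rightarrow> 'a poly \<Rightarrow> 'a poly"
  by unfold_locales (auto simp: smult_add_right smult_add_left)

text \<open>Words of length \<open>n\<close> are represented by their generating polynomials.\<close>

definition words :: "nat \<Rightarrow> 'a::zero poly set" where
  "words n = {p. \<forall>j\<ge>n. coeff p j = 0}"

lemma words_eq_image: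
  "words n = (\<lambda>f. \<Sum>j<n. monom (f j) j) ` ({..<n} \<rightarrow>\<^sub>E (UNIV :: 'a::comm_monoid_add set))"
proof (intro equalityI subsetI)
  fix p :: "'a poly" assume p: "p \<in> words n"
  have "p = (\<Sum>j<n. monom (restrict (coeff p) {..<n} j) j)"
    using p by (intro poly_eqI) (auto simp: coeff_sum words_def)
  thus "p \<in> (\<lambda>f. \<Sum>j<n. monom (f j) j) ` ({..<n} \<rightarrow>\<^sub>E UNIV)"
    by (rule image_eqI[where x = "restrict (coeff p) {..<n}"]) auto
next
  fix p :: "'a poly" assume "p \<in> (\<lambda>f. \<Sum>j<n. monom (f j) j) ` ({..<n} \<rightarrow>\<^sub>E UNIV)"
  then obtain f where "p = (\<Sum>j<n. monom (f j) j)" by (rule imageE)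
  thus "p \<in> words n" by (simp add: words_def coeff_sum)
qed

lemma finite_words [simp]: "finite (words n :: 'a::{comm_monoid_add,finite} poly set)"
  unfolding words_eq_image by (intro finite_imageI finite_PiE) auto

lemma card_words: "card (words n :: 'a::{comm_monoid_add,finite} poly set) = CARD('a) ^ n"
proof -
  have "inj_on (\<lambda>f. \<Sum>j<n. monom (f j) j) ({..<n} \<rightarrow>\<^sub>E (UNIV :: 'a set))"
  proof (rule inj_onI)
    fix f g assume fg: "f \<in> {..<n} \<rightarrow>\<^sub>E (UNIV :: 'a set)" "g \<in> {..<n} \<rightarrow>\<^sub>E (UNIV :: 'a set)"
      and eq: "(\<Sum>j<n. monom (f j) j) = (\<Sum>j<n. monom (g j) j)"
    have "f j = g j" if "j < n" for j
      using arg_cong[OF eq, of "\<lambda>p. coeff p j"] that by (simp add: coeff_sum)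
    thus "f = g" using fg by (intro PiE_ext) auto
  qed
  thus ?thesis unfolding words_eq_image by (simp add: card_image card_funcsetE)
qed

lemma card_span_le:
  fixes B :: "'a::{field,finite} poly set"
  assumes "finite B"
  shows "finite (poly_space.span B)" "card (poly_space.span B) \<le> CARD('a) ^ card B"
proof -
  let ?f = "\<lambda>u. \<Sum>v\<in>B. smult (u v) v"
  have "poly_space.span B \<subseteq> ?f ` (B \<rightarrow>\<^sub>E UNIV)"
  proof
    fix x assume "x \<in> poly_space.span B"
    then obtain u where "x = ?f u" using assms by (auto simp: poly_space.span_finite)
    hence "x = ?f (restrict u B)" by simp
    thus "x \<in> ?f ` (B \<rightarrow>\<^sub>E UNIV)"
      by (rule image_eqI[where x = "restrict u B"]) auto
  qed
  moreover have "finite (B \<rightarrow>\<^sub>E (UNIV :: 'a set))" using assms by (intro finite_PiE) auto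
  ultimately show "finite (poly_space.span B)" "card (poly_space.span B) \<le> CARD('a) ^ card B"
    using surj_card_le[of "B \<rightarrow>\<^sub>E UNIV" "poly_space.span B" ?f] assms
    by (auto simp: card_funcsetE intro: finite_subset)
qed

text \<open>Cardinality stands in for dimension: a maximal independent extension of \<open>S\<close>
  spans \<open>V\<close> and so has at least \<open>k\<close> elements; surplus ones outside
  \<open>S\<close> are dropped.\<close>

lemma independent_extend_card:
  fixes V :: "'a::{field,finite} poly set"
  assumes V: "finite V" "CARD('a) ^ k \<le> card V"
    and S: "S \<subseteq> V" "poly_space.independent S" "card S \<le> k"
  obtains B where "S \<subseteq> B" "B \<subseteq> V" "poly_space.independent B" "card B = k"
proof -
  obtain B where B: "S \<subseteq> B" "B \<subseteq> V" "poly_space.independent B" "V \<subseteq> poly_space.span B"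
    using poly_space.maximal_independent_subset_extend S by metis
  have fin: "finite B" by (rule finite_subset[OF B(2) V(1)])
  have "CARD('a) ^ k \<le> CARD('a) ^ card B"
    using V(2) card_mono[OF card_span_le(1)[OF fin] B(4)] card_span_le(2)[OF fin] by linarith
  hence "k \<le> card B" by (meson power_le_imp_le_exp finite_field_card_gt_1)
  hence "k - card S \<le> card (B - S)" using B(1) fin
    by (subst card_Diff_subset) (auto intro: finite_subset)
  then obtain T where T: "T \<subseteq> B - S" "card T = k - card S" "finite T"
    using obtain_subset_with_card_n by metis
  have "finite S" using fin B(1) finite_subset by auto
  have "card (S \<union> T) = k"
    using T S(3) \<open>finite S\<close> by (subst card_Un_disjoint) auto
  moreover have "poly_space.independent (S \<union> T)"
    using B T by (intro poly_space.independent_mono[OF B(3)]) auto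
  ultimately show thesis using that[of "S \<union> T"] B T by blast
qed

section \<open>Independent words and dual families\<close>

lemma independent_Un_subspaces:
  assumes "poly_space.subspace V" "poly_space.subspace W" "V \<inter> W = {0}"
    and B: "B \<subseteq> V" "finite B" "poly_space.independent B"
    and C: "C \<subseteq> W" "finite C" "poly_space.independent C"
  shows "B \<inter> C = {}" "poly_space.independent (B \<union> C)"
proof -
  have "0 \<notin> B" using B(3) poly_space.dependent_zero by auto
  moreover have "B \<inter> C \<subseteq> V \<inter> W" using B(1) C(1) by blast
  ultimately show disj: "B \<inter> C = {}" using assms(3) by auto
  show "poly_space.independent (B \<union> C)"
  proof (rule poly_space.independent_if_scalars_zero)
    fix f x assume "(\<Sum>x\<in>B \<union> C. smult (f x) x) = 0" and x: "x \<in> B \<union> C"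
    hence sum: "(\<Sum>x\<in>B. smult (f x) x) + (\<Sum>x\<in>C. smult (f x) x) = 0"
      using disj B C by (simp add: sum.union_disjoint)
    have V: "(\<Sum>x\<in>B. smult (f x) x) \<in> V"
      using B by (intro poly_space.subspace_sum poly_space.subspace_scale assms) auto
    have W: "(\<Sum>x\<in>C. smult (f x) x) \<in> W"
      using C by (intro poly_space.subspace_sum poly_space.subspace_scale assms) auto
    \<comment> \<open>The part of the relation over \<open>B\<close> is minus the part over
      \<open>C\<close>, hence lies in both subspaces.\<close>
    have "(\<Sum>x\<in>B. smult (f x) x) \<in> W"
      using poly_space.subspace_neg[OF assms(2) W] sum by (simp add: eq_neg_iff_add_eq_0[symmetric])
    hence z: "(\<Sum>x\<in>B. smult (f x) x) = 0" using V assms(3) by auto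
    hence z': "(\<Sum>x\<in>C. smult (f x) x) = 0" using sum by simp
    from x show "f x = 0"
      using poly_space.independentD[OF B(3,2) subset_refl z]
        poly_space.independentD[OF C(3,2) subset_refl z'] by auto
  qed (use B C in auto)
qed

text \<open>Each coordinate functional on the independent list extends to a linear functional on all
  polynomials; \<open>R j t\<close> is the value of the \<open>t\<close>-th one at
  \<open>monom 1 j\<close>.\<close>

lemma biorthogonal_family:
  fixes xs :: "'a::field poly list"
  assumes "poly_space.independent (set xs)" "distinct xs" "set xs \<subseteq> words n"
  obtains R :: "nat \<Rightarrow> nat \<Rightarrow> 'a" where
    "\<And>s t. s < length xs \<Longrightarrow> t < length xs \<Longrightarrow>
      (\<Sum>j<n. coeff (xs ! s) j * R j t) = (if s = t then 1 else 0)"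
proof -
  interpret vector_space_pair "smult :: 'a \<Rightarrow> 'a poly \<Rightarrow> 'a poly" "(*) :: 'a \<Rightarrow> 'a \<Rightarrow> 'a"
    by unfold_locales (auto simp: algebra_simps)
  have "\<exists>h. Vector_Spaces.linear smult (*) h \<and> (\<forall>x\<in>set xs. h x = (if x = xs ! t then 1 else 0))" for t
    by (rule linear_independent_extend[OF assms(1)])
  then obtain h where lin: "\<And>t. Vector_Spaces.linear smult (*) (h t)"
    and h: "\<And>t x. x \<in> set xs \<Longrightarrow> h t x = (if x = xs ! t then 1 else 0)" by metis
  have "(\<Sum>j<n. coeff (xs ! s) j * h t (monom 1 j)) = (if s = t then 1 else 0)"
    if st: "s < length xs" "t < length xs" for s t
  proof -
    interpret ht: Vector_Spaces.linear smult "(*)" "h t" by (rule lin)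
    have "xs ! s \<in> words n" using assms(3) st nth_mem by blast
    hence "xs ! s = (\<Sum>j<n. smult (coeff (xs ! s) j) (monom 1 j))"
      by (intro poly_eqI) (auto simp: coeff_sum smult_monom words_def)
    hence "h t (xs ! s) = (\<Sum>j<n. coeff (xs ! s) j * h t (monom 1 j))"
      by (metis (no_types, lifting) ht.scale ht.sum sum.cong)
    thus ?thesis using st assms(2) h[of "xs ! s" t] by (simp add: nth_eq_iff_index_eq)
  qed
  thus thesis by (rule that[of "\<lambda>j t. h t (monom 1 j)"])
qed

text \<open>Choose \<open>K\<close> in \<open>N0 \<inter> N1\<close>, extend it inside
  \<open>N0\<close> by \<open>g\<close> words, and append \<open>g\<close> independent words of
  \<open>A\<close>. Since \<open>A\<close> meets \<open>N0\<close> trivially, the whole family is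
  independent.\<close>

lemma exists_unit_memory_words:
  fixes N0 N1 A :: "'a::{field,finite} poly set"
  assumes sub: "poly_space.subspace N0" "poly_space.subspace A"
    and words: "N0 \<subseteq> words n" "N1 \<subseteq> words n"
    and A: "A \<subseteq> N1" "N0 \<inter> A = {0}"
    and card: "CARD('a) ^ m \<le> card (N0 \<inter> N1)" "CARD('a) ^ (m + g) \<le> card N0" "CARD('a) ^ g \<le> card A"
    and g: "g > 0"
  obtains w R where "unit_memory_words n m g (\<lambda>s. coeff (w s)) R"
    "\<And>s. s < m + g \<Longrightarrow> w s \<in> N0"
    "\<And>s. s \<in> {..<m} \<union> {m + g..<m + 2 * g} \<Longrightarrow> w s \<in> N1"
proof -
  have fin: "finite N0" "finite N1" "finite A"
    using words A finite_words finite_subset by metis+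
  obtain K where K: "K \<subseteq> N0 \<inter> N1" "poly_space.independent K" "card K = m"
    using independent_extend_card[of "N0 \<inter> N1" m "{}"] fin card
    by (auto simp: poly_space.independent_empty)
  obtain KC where KC: "K \<subseteq> KC" "KC \<subseteq> N0" "poly_space.independent KC" "card KC = m + g"
    using independent_extend_card[of N0 "m + g" K] fin card K by auto
  obtain B where B: "B \<subseteq> A" "poly_space.independent B" "card B = g"
    using independent_extend_card[of A g "{}"] fin card
    by (auto simp: poly_space.independent_empty)
  have fin': "finite K" "finite KC" "finite B" using fin KC B finite_subset by metis+
  note un = independent_Un_subspaces[OF sub A(2) KC(2) fin'(2) KC(3) B(1) fin'(3) B(2)]
  obtain xs where xs: "set xs = K" "distinct xs" using finite_distinct_list fin' by metis
  obtain ys where ys: "set ys = KC - K" "distinct ys" using finite_distinct_list fin' by (metis finite_Diff)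
  obtain zs where zs: "set zs = B" "distinct zs" using finite_distinct_list fin' by metis
  have len: "length xs = m" "length ys = g" "length zs = g"
    using xs ys zs K KC B fin' by (auto simp: distinct_card[symmetric] card_Diff_subset)
  define ws where "ws = xs @ ys @ zs"
  have "set ws = KC \<union> B" using xs ys zs KC by (auto simp: ws_def)
  moreover have "distinct ws" using xs ys zs un(1) KC(1) by (auto simp: ws_def)
  moreover have "KC \<union> B \<subseteq> words n" using KC B A words by auto
  ultimately obtain R where R: "\<And>s t. s < length ws \<Longrightarrow> t < length ws \<Longrightarrow>
      (\<Sum>j<n. coeff (ws ! s) j * R j t) = (if s = t then 1 else 0)"
    using biorthogonal_family[of ws n] un(2) by metis
  show thesis
  proof (rule that[of "(!) ws" R])
    show "unit_memory_words n m g (\<lambda>s. coeff (ws ! s)) R"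
      using R g by unfold_locales (auto simp: ws_def len)
  next
    fix s assume s: "s < m + g"
    hence "ws ! s = (xs @ ys) ! s" unfolding ws_def append_assoc[symmetric] by (subst nth_append) (simp add: len)
    hence "ws ! s \<in> set (xs @ ys)" using s by (metis len(1,2) length_append nth_mem)
    thus "ws ! s \<in> N0" using xs ys KC by auto
  next
    fix s assume s: "s \<in> {..<m} \<union> {m + g..<m + 2 * g}"
    show "ws ! s \<in> N1"
    proof (cases "s < m")
      case True
      hence "ws ! s \<in> set xs" by (simp add: ws_def nth_append len)
      thus ?thesis using xs K by auto
    next
      case False
      hence "ws ! s = zs ! (s - m - g)" "s - m - g < g" using s by (auto simp: ws_def nth_append len)
      hence "ws ! s \<in> set zs" using len nth_mem by metis
      thus ?thesis using zs B A by auto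
    qed
  qed
qed

section \<open>Roots of unity and the BCH bound\<close>

text \<open>Over an algebraically closed field \<open>X^n - 1\<close> splits, and its roots are
  simple: a double root would be a zero of the derivative \<open>n X^(n-1)\<close>, thus 0, which is
  not a root.\<close>

lemma card_roots_of_unity:
  assumes "of_nat n \<noteq> (0 :: 'a::alg_closed_field)"
  shows "card {x :: 'a. x ^ n = 1} = n"
proof -
  have n: "n > 0" using assms by (intro Nat.gr0I) auto
  define p :: "'a poly" where "p = monom 1 n - 1"
  have deg: "degree p = n"
    unfolding p_def using n degree_add_eq_left[of "-1" "monom 1 n :: 'a poly"] by (simp add: degree_monom_eq)
  have "p \<noteq> 0" using deg n by auto
  obtain A where A: "size A = n" "p = smult (lead_coeff p) (\<Prod>x\<in>#A. [:-x, 1:])"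
    using alg_closed_imp_factorization[OF \<open>p \<noteq> 0\<close>] deg by auto
  have root: "poly p x = 0 \<longleftrightarrow> x \<in># A" for x
    by (subst A(2)) (use \<open>p \<noteq> 0\<close> in \<open>auto simp: poly_prod_mset prod_mset_zero_iff\<close>)
  have "count A x \<le> 1" for x
  proof (rule ccontr)
    assume "\<not> count A x \<le> 1"
    hence "x \<in># A" by (metis count_eq_zero_iff zero_le)
    then obtain A' where A': "A = add_mset x A'" by (meson multi_member_split)
    with \<open>\<not> count A x \<le> 1\<close> have "x \<in># A'" by simp
    then obtain B where "A' = add_mset x B" by (meson multi_member_split)
    hence B: "A = add_mset x (add_mset x B)" using A' by simp
    hence "p = [:-x, 1:] * ([:-x, 1:] * smult (lead_coeff p) (\<Prod>x\<in>#B. [:-x, 1:]))"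
      using A(2) by (simp del: mult_pCons_left)
    then obtain r where "p = [:-x, 1:] * ([:-x, 1:] * r)" by blast
    hence "pderiv p = [:-x, 1:] * pderiv ([:-x, 1:] * r) + [:-x, 1:] * r * pderiv [:-x, 1:]"
      by (simp only: pderiv_mult)
    hence "poly (pderiv p) x = 0" by (simp del: mult_pCons_left)
    moreover have "poly (pderiv p) x = of_nat n * x ^ (n - 1)"
      by (simp add: p_def pderiv_diff pderiv_monom poly_monom)
    ultimately have "x = 0" using assms by simp
    thus False using root[of x] \<open>x \<in># A\<close> n by (simp add: p_def poly_monom power_0_left)
  qed
  hence "A = mset_set (set_mset A)"
    by (intro multiset_eqI) (metis count_eq_zero_iff count_mset_set(1,3) finite_set_mset
      le_antisym less_one linorder_not_less)
  hence "n = card (set_mset A)" using A(1) by (metis size_mset_set)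
  also have "set_mset A = {x. x ^ n = 1}" using root by (auto simp: p_def poly_monom)
  finally show ?thesis by simp
qed

text \<open>If some root \<open>z\<close> has \<open>z ^ s \<noteq> 1\<close>, multiplication by
  \<open>z\<close> permutes the roots and scales the sum by \<open>z ^ s\<close>, which forces it to
  vanish.\<close>

lemma sum_roots_of_unity_power:
  fixes n s :: nat
  assumes n: "n > 0" and card: "card {x :: 'a::field. x ^ n = 1} = n"
  shows "(\<Sum>x | x ^ n = 1. x ^ s) = (if n dvd s then of_nat n else (0 :: 'a))"
proof (cases "n dvd s")
  case True
  then obtain k where "s = n * k" by blast
  hence "(\<Sum>x :: 'a | x ^ n = 1. x ^ s) = (\<Sum>x :: 'a | x ^ n = 1. 1)"
    by (intro sum.cong) (auto simp: power_mult)
  thus ?thesis using True card by simp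
next
  case False
  \<comment> \<open>Reducing the exponent below \<open>n\<close> leaves \<open>X^r - 1\<close> with
    fewer than \<open>n\<close> roots, so a suitable \<open>z\<close> exists.\<close>
  define r where "r = s mod n"
  have r: "0 < r" "r < n" using False n by (auto simp: r_def dvd_eq_mod_eq_0)
  have pow_r: "x ^ s = x ^ r" if "x ^ n = 1" for x :: 'a
  proof -
    have "x ^ s = x ^ (n * (s div n) + r)" by (simp add: r_def)
    thus ?thesis using that by (simp only: power_add power_mult power_one mult_1_left)
  qed
  have "\<exists>z :: 'a. z ^ n = 1 \<and> z ^ r \<noteq> 1"
  proof (rule ccontr)
    assume neg: "\<not> (\<exists>z :: 'a. z ^ n = 1 \<and> z ^ r \<noteq> 1)"
    define p :: "'a poly" where "p = monom 1 r - 1"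
    have deg: "degree p = r"
      unfolding p_def using r degree_add_eq_left[of "-1" "monom 1 r :: 'a poly"] by (simp add: degree_monom_eq)
    hence "p \<noteq> 0" using r by auto
    have "card {x :: 'a. x ^ n = 1} \<le> card {x. poly p x = 0}"
      using neg poly_roots_finite[OF \<open>p \<noteq> 0\<close>]
      by (intro card_mono) (auto simp: p_def poly_monom)
    also have "\<dots> \<le> r" using card_poly_roots_bound[OF \<open>p \<noteq> 0\<close>] deg by simp
    finally show False using r card by simp
  qed
  then obtain z :: 'a where z: "z ^ n = 1" "z ^ r \<noteq> 1" by blast
  have "z \<noteq> 0" using z n by (auto simp: power_0_left)
  have "(\<Sum>x | x ^ n = 1. x ^ s) = (\<Sum>x | x ^ n = 1. (z * x) ^ s)"
    by (rule sum.reindex_bij_witness[where i = "\<lambda>x. z * x" and j = "\<lambda>x. x / z"])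
       (use z \<open>z \<noteq> 0\<close> in \<open>auto simp: power_mult_distrib power_divide\<close>)
  also have "\<dots> = z ^ r * (\<Sum>x | x ^ n = 1. x ^ s)"
    using pow_r[of z] z by (simp add: power_mult_distrib sum_distrib_left)
  finally have "(1 - z ^ r) * (\<Sum>x | x ^ n = 1. x ^ s) = 0" by (simp add: algebra_simps)
  thus ?thesis using z False by simp
qed

text \<open>Testing the power sums against the polynomial that vanishes at all points of the support
  but one replaces the Vandermonde determinant.\<close>

lemma BCH_bound:
  fixes c z :: "'b \<Rightarrow> 'a::field"
  assumes S: "finite S" "card S \<le> d" and inj: "inj_on z S" and nz: "\<And>j. j \<in> S \<Longrightarrow> z j \<noteq> 0"
    and zero: "\<And>t. b \<le> t \<Longrightarrow> t < b + d \<Longrightarrow> (\<Sum>j\<in>S. c j * z j ^ t) = 0"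
    and k: "k \<in> S"
  shows "c k = 0"
proof -
  define P where "P = (\<Prod>i\<in>S - {k}. [:- z i, 1:])"
  have "degree P \<le> (\<Sum>i\<in>S - {k}. degree [:- z i, 1:])"
    unfolding P_def using S(1) by (intro degree_prod_sum_le[unfolded comp_def]) auto
  also have "\<dots> = card (S - {k})" by simp
  also have "\<dots> < d" using card_Diff1_less[OF S(1) k] S(2) by linarith
  finally have deg: "degree P < d" .
  have "0 = (\<Sum>t\<le>degree P. coeff P t * (\<Sum>j\<in>S. c j * z j ^ (b + t)))"
    using deg zero by (simp add: sum.neutral)
  also have "\<dots> = (\<Sum>j\<in>S. c j * z j ^ b * poly P (z j))"
    by (subst poly_altdef) (simp add: sum_distrib_left power_add mult_ac, rule sum.swap)
  also have "\<dots> = c k * z k ^ b * poly P (z k)"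
  proof -
    have "poly P (z j) = 0" if "j \<in> S" "j \<noteq> k" for j
      unfolding P_def using that S(1) by (auto simp: poly_prod)
    hence "(\<Sum>j\<in>S. c j * z j ^ b * poly P (z j)) = (\<Sum>j\<in>{k}. c j * z j ^ b * poly P (z j))"
      using S k by (intro sum.mono_neutral_right) auto
    thus ?thesis by simp
  qed
  finally have "c k * z k ^ b * poly P (z k) = 0" by simp
  moreover have "poly P (z k) \<noteq> 0"
    unfolding P_def using inj k S(1) by (auto simp: poly_prod inj_on_def)
  ultimately show ?thesis using nz[OF k] by simp
qed

text \<open>Subtracting a fixed element of a fibre embeds that fibre into \<open>N\<close>.\<close>

lemma card_le_card_image_times_kernel:
  fixes f :: "'a::ab_group_add \<Rightarrow> 'b"
  assumes P: "finite P" "\<And>x y. x \<in> P \<Longrightarrow> y \<in> P \<Longrightarrow> f x = f y \<Longrightarrow> x - y \<in> N"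
    and N: "finite N" and T: "f ` P \<subseteq> T" "finite T"
  shows "card P \<le> card T * card N"
proof -
  have "card {x \<in> P. f x = y} \<le> card N" for y
  proof (cases "\<exists>x0\<in>P. f x0 = y")
    case True
    then obtain x0 where x0: "x0 \<in> P" "f x0 = y" by blast
    have "card {x \<in> P. f x = y} \<le> card N"
      by (rule card_inj_on_le[of "\<lambda>x. x - x0"]) (use x0 P N in \<open>auto simp: inj_on_def\<close>)
    thus ?thesis .
  next
    case False
    hence "{x \<in> P. f x = y} = {}" by auto
    thus ?thesis by (simp only: card.empty)
  qed
  moreover have "P = (\<Union>y\<in>T. {x \<in> P. f x = y})" using T by auto
  hence "card P \<le> (\<Sum>y\<in>T. card {x \<in> P. f x = y})" using card_UN_le[OF T(2)] by metis
  ultimately show ?thesis using sum_bounded_above[of T "\<lambda>y. card {x \<in> P. f x = y}" "card N"] by fastforce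
qed

section \<open>The Frobenius map and the base field inside its closure\<close>

lemma power_CARD_eq_self: "x ^ CARD('a) = (x :: 'a::{field,finite})"
proof (cases "x = 0")
  case False
  \<comment> \<open>Multiplication by \<open>x\<close> permutes the nonzero elements and preserves
    their product.\<close>
  have "(\<Prod>y\<in>UNIV - {0}. x * y) = \<Prod>(UNIV - {0})"
    by (rule prod.reindex_bij_witness[where i = "\<lambda>y. y / x" and j = "\<lambda>y. x * y"]) (use False in auto)
  hence "x ^ (CARD('a) - 1) * \<Prod>(UNIV - {0}) = \<Prod>(UNIV - {0 :: 'a})"
    by (simp add: prod.distrib card_Diff_singleton)
  hence "x ^ (CARD('a) - 1) = 1" by simp
  hence "x ^ Suc (CARD('a) - 1) = x" by (simp only: power_Suc mult_1_right)
  moreover have "Suc (CARD('a) - 1) = CARD('a)" using finite_field_card_gt_1[where 'a = 'a] by simp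
  ultimately show ?thesis by (simp only:)
qed (use finite_field_card_gt_1[where 'a = 'a] in simp)

lemma CARD_eq_CHAR_power:
  assumes "primepow CARD('a::{field,finite})"
  obtains k where "prime CHAR('a)" "CARD('a) = CHAR('a) ^ k" "k > 0"
proof -
  have "prime CHAR('a)" by (intro prime_CHAR_semidom finite_imp_CHAR_pos) auto
  moreover obtain p k where pk: "prime p" "k > 0" "CARD('a) = p ^ k"
    using assms by (auto simp: primepow_def)
  ultimately have "CHAR('a) = p"
    using CHAR_dvd_CARD[where 'a = 'a] by (metis prime_dvd_power primes_dvd_imp_eq)
  thus thesis using that pk by auto
qed

text \<open>The field size is a power of the characteristic, so this is an iterated Frobenius
  map.\<close>

lemma Frobenius_sum:
  fixes f :: "'b \<Rightarrow> 'a::{field,finite} alg_closure"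
  assumes "primepow CARD('a)"
  shows "sum f A ^ CARD('a) = (\<Sum>x\<in>A. f x ^ CARD('a))"
    and "sum f A ^ (CARD('a)\<^sup>2) = (\<Sum>x\<in>A. f x ^ (CARD('a)\<^sup>2))"
proof -
  obtain k where k: "prime CHAR('a)" "CARD('a) = CHAR('a) ^ k"
    using CARD_eq_CHAR_power[OF assms] .
  show *: "sum f A ^ CARD('a) = (\<Sum>x\<in>A. f x ^ CARD('a))" for f :: "'b \<Rightarrow> 'a alg_closure"
    by (rule freshmans_dream_sum'[where n = k]) (use k in auto)
  show "sum f A ^ (CARD('a)\<^sup>2) = (\<Sum>x\<in>A. f x ^ (CARD('a)\<^sup>2))"
    by (simp add: power2_eq_square power_mult *)
qed

text \<open>The base field already supplies \<open>q\<close> roots of \<open>X^q - X\<close>, with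
  \<open>q\<close> its size, and there are no more.\<close>

lemma in_range_to_ac:
  fixes y :: "'a::{field,finite} alg_closure"
  assumes "y ^ CARD('a) = y"
  shows "y \<in> range to_ac"
proof -
  let ?q = "CARD('a)"
  define p :: "'a alg_closure poly" where "p = monom 1 ?q - monom 1 1"
  have q: "?q > 1" by (rule finite_field_card_gt_1)
  have deg: "degree p = ?q"
    unfolding p_def using q degree_add_eq_left[of "- monom 1 1" "monom 1 ?q :: 'a alg_closure poly"]
    by (simp add: degree_monom_eq)
  hence "p \<noteq> 0" using q by auto
  have roots: "{x. poly p x = 0} = {x. x ^ ?q = x}" by (auto simp: p_def poly_monom)
  have fin: "finite {x :: 'a alg_closure. x ^ ?q = x}" using poly_roots_finite[OF \<open>p \<noteq> 0\<close>] roots by simp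
  have "range to_ac = {x :: 'a alg_closure. x ^ ?q = x}"
  proof (rule card_subset_eq[OF fin])
    show sub: "range (to_ac :: 'a \<Rightarrow> _) \<subseteq> {x. x ^ ?q = x}"
      by (auto simp flip: to_ac_power simp: power_CARD_eq_self)
    have "card (range (to_ac :: 'a \<Rightarrow> _)) = ?q" by (rule card_image[OF inj_to_ac])
    moreover have "card {x :: 'a alg_closure. x ^ ?q = x} \<le> ?q"
      using card_poly_roots_bound[OF \<open>p \<noteq> 0\<close>] deg roots by simp
    ultimately show "card (range (to_ac :: 'a \<Rightarrow> _)) = card {x :: 'a alg_closure. x ^ ?q = x}"
      using card_mono[OF fin sub] by simp
  qed
  thus ?thesis using assms by auto
qed

section \<open>Codes with prescribed zeros\<close>

lemma of_nat_CARD_power2_minus_1: "of_nat (CARD('a::{field,finite})\<^sup>2 - 1) = (- 1 :: 'a alg_closure)"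
proof -
  have "CHAR('a) dvd CARD('a)\<^sup>2" using CHAR_dvd_CARD[where 'a = 'a] by (simp add: power2_eq_square)
  also have "CARD('a)\<^sup>2 = Suc (CARD('a)\<^sup>2 - 1)" using finite_field_card_gt_1[where 'a = 'a] by simp
  finally have "of_nat (Suc (CARD('a)\<^sup>2 - 1)) = (0 :: 'a alg_closure)"
    by (simp only: of_nat_eq_0_iff_char_dvd CHAR_alg_closure)
  thus ?thesis by (simp add: add_eq_0_iff)
qed

text \<open>The points come in an arbitrary order: a word is a function on them, and
  \<open>coeff p j\<close> is its value at \<open>e j\<close>.\<close>

locale BCH_points =
  fixes n q :: nat and e :: "nat \<Rightarrow> 'a::{field,finite} alg_closure"
  assumes primepow: "primepow q" and q: "CARD('a) = q" and n: "n = q\<^sup>2 - 1"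
    and e: "bij_betw e {..<n} {x. x ^ n = 1}"
begin

definition syndrome :: "'a poly \<Rightarrow> nat \<Rightarrow> 'a alg_closure" where
  "syndrome p t = (\<Sum>j<n. to_ac (coeff p j) * e j ^ t)"

definition zero_code :: "nat set \<Rightarrow> 'a poly set" where
  "zero_code J = {p \<in> words n. \<forall>t\<in>J. syndrome p t = 0}"

text \<open>The field with \<open>q\<^sup>2\<close> elements, realised inside the closure as a set
  of Frobenius fixed points.\<close>

definition F2 :: "'a alg_closure set" where
  "F2 = {x. x ^ q\<^sup>2 = x}"

lemma q_gt_1: "q > 1"
  using finite_field_card_gt_1[where 'a = 'a] by (simp add: q)

lemma Frobenius:
  fixes f :: "'b \<Rightarrow> 'a alg_closure"
  shows "sum f A ^ q = (\<Sum>x\<in>A. f x ^ q)"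
    and "sum f A ^ q\<^sup>2 = (\<Sum>x\<in>A. f x ^ q\<^sup>2)"
  using Frobenius_sum[where 'a = 'a] primepow by (simp_all add: q)

lemma Frobenius_add:
  fixes x y :: "'a alg_closure"
  shows "(x + y) ^ q = x ^ q + y ^ q" and "(x + y) ^ q\<^sup>2 = x ^ q\<^sup>2 + y ^ q\<^sup>2"
  using Frobenius[of "\<lambda>b. if b then x else y" UNIV] by (simp_all add: UNIV_bool add.commute)

lemma q2_eq: "q\<^sup>2 = Suc n"
  using q_gt_1 by (simp add: n)

lemma of_nat_n: "of_nat n = (- 1 :: 'a alg_closure)"
  using of_nat_CARD_power2_minus_1[where 'a = 'a] by (simp add: n q)

lemma card_roots: "card {x :: 'a alg_closure. x ^ n = 1} = n"
  by (rule card_roots_of_unity) (simp add: of_nat_n)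

lemma n_pos: "n > 0"
  using of_nat_n by (intro Nat.gr0I) auto

lemma e_power_n: "j < n \<Longrightarrow> e j ^ n = 1"
  using e by (auto simp: bij_betw_def)

lemma e_nonzero: "j < n \<Longrightarrow> e j \<noteq> 0"
  using e_power_n[of j] n_pos by (auto simp: power_0_left)

lemma e_F2: "j < n \<Longrightarrow> (e j ^ t) ^ q\<^sup>2 = e j ^ t"
proof -
  assume "j < n"
  have "(e j ^ t) ^ q\<^sup>2 = (e j ^ t) * (e j ^ n) ^ t"
    unfolding q2_eq by (simp flip: power_mult add: mult.commute)
  thus ?thesis using e_power_n[OF \<open>j < n\<close>] by simp
qed

lemma sum_e_power: "(\<Sum>j<n. e j ^ s) = (if n dvd s then of_nat n else 0)"
  using sum_roots_of_unity_power[OF n_pos card_roots] sum.reindex_bij_betw[OF e, of "\<lambda>x. x ^ s"] by simp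

lemma F2_eq: "F2 = insert 0 {x. x ^ n = 1}"
  by (auto simp: F2_def q2_eq)

lemma card_F2: "card F2 = q\<^sup>2" and finite_F2 [simp]: "finite F2"
proof -
  have fin: "finite {x :: 'a alg_closure. x ^ n = 1}" using card_roots n_pos by (metis card.infinite less_irrefl)
  have "(0 :: 'a alg_closure) \<notin> {x. x ^ n = 1}" using n_pos by (simp add: power_0_left)
  thus "card F2 = q\<^sup>2" "finite F2" using fin unfolding F2_eq by (simp_all add: card_roots q2_eq)
qed

lemma to_ac_power_q: "to_ac x ^ q = to_ac (x :: 'a)"
  using power_CARD_eq_self[of x] by (simp flip: to_ac_power add: q)

lemma syndrome_F2: "syndrome p t \<in> F2"
proof -
  have "to_ac (coeff p j) ^ q\<^sup>2 = to_ac (coeff p j)" for j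
    by (simp add: power2_eq_square power_mult to_ac_power_q)
  thus ?thesis
    by (simp add: F2_def syndrome_def Frobenius(2) power_mult_distrib e_F2)
qed

text \<open>Coefficients in the base field are fixed by the \<open>q\<close>-th power. Hence a zero
  at \<open>t\<close> entails one at \<open>q * t\<close>.\<close>

lemma syndrome_Frobenius: "syndrome p (q * t) = syndrome p t ^ q"
  by (simp add: syndrome_def Frobenius(1) power_mult_distrib to_ac_power_q
       flip: power_mult add: mult.commute)

lemma syndrome_add: "syndrome (x + y) t = syndrome x t + syndrome y t"
  by (simp add: syndrome_def algebra_simps sum.distrib)

lemma syndrome_diff: "syndrome (x - y) t = syndrome x t - syndrome y t"
  by (simp add: syndrome_def algebra_simps sum_subtractf)

lemma syndrome_smult: "syndrome (smult c x) t = to_ac c * syndrome x t"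
  by (simp add: syndrome_def algebra_simps sum_distrib_left)

lemma syndrome_0: "syndrome 0 t = 0"
  by (simp add: syndrome_def)

lemma subspace_zero_code: "poly_space.subspace (zero_code J)"
  by (rule poly_space.subspaceI)
     (auto simp: zero_code_def words_def syndrome_0 syndrome_add syndrome_smult)

lemma zero_code_subset: "zero_code J \<subseteq> words n"
  by (auto simp: zero_code_def)

lemma zero_code_Int: "zero_code I \<inter> zero_code J = zero_code (I \<union> J)"
  by (auto simp: zero_code_def)

text \<open>Each syndrome takes at most \<open>q\<^sup>2\<close> values, so each prescribed zero
  costs at most two dimensions.\<close>

lemma card_zero_code_ge:
  assumes J: "finite J" and le: "k + 2 * card J \<le> n"
  shows "q ^ k \<le> card (zero_code J)"
proof -
  have "card (words n :: 'a poly set) \<le> card (J \<rightarrow>\<^sub>E F2) * card (zero_code J)"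
  proof (rule card_le_card_image_times_kernel[where f = "\<lambda>p. \<lambda>t\<in>J. syndrome p t"])
    fix x y :: "'a poly" assume xy: "x \<in> words n" "y \<in> words n"
      and eq: "(\<lambda>t\<in>J. syndrome x t) = (\<lambda>t\<in>J. syndrome y t)"
    have "syndrome x t = syndrome y t" if "t \<in> J" for t
      using fun_cong[OF eq, of t] that by simp
    thus "x - y \<in> zero_code J" using xy by (auto simp: zero_code_def words_def syndrome_diff)
  qed (use J finite_subset[OF zero_code_subset finite_words, of J] in \<open>auto simp: syndrome_F2 intro!: finite_PiE\<close>)
  hence "q ^ n \<le> q ^ (2 * card J) * card (zero_code J)"
    using J by (simp add: card_words q card_funcsetE card_F2 power_mult)
  moreover have "q ^ (2 * card J) * q ^ k \<le> q ^ n"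
    unfolding power_add[symmetric] using le q_gt_1 by (intro power_increasing) auto
  ultimately have "q ^ (2 * card J) * q ^ k \<le> q ^ (2 * card J) * card (zero_code J)" by linarith
  thus ?thesis using q_gt_1 by simp
qed

lemma word_weight_ge:
  assumes zero: "\<And>t. b \<le> t \<Longrightarrow> t < b + d \<Longrightarrow> syndrome p t = 0"
    and k: "k < n" "coeff p k \<noteq> 0"
  shows "Suc d \<le> word_weight n (coeff p)"
proof (rule ccontr)
  assume neg: "\<not> Suc d \<le> word_weight n (coeff p)"
  define S where "S = {j. j < n \<and> coeff p j \<noteq> 0}"
  have "to_ac (coeff p k) = 0"
  proof (rule BCH_bound[where S = S and z = e and d = d and b = b])
    show "card S \<le> d" using neg by (simp add: S_def word_weight_def)
    show "inj_on e S" using e by (rule inj_on_subset[OF bij_betw_imp_inj_on]) (auto simp: S_def)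
    fix t assume t: "b \<le> t" "t < b + d"
    have "(\<Sum>j\<in>S. to_ac (coeff p j) * e j ^ t) = syndrome p t"
      unfolding syndrome_def by (intro sum.mono_neutral_left) (auto simp: S_def)
    thus "(\<Sum>j\<in>S. to_ac (coeff p j) * e j ^ t) = 0" using zero[OF t] by simp
  qed (use k e_nonzero in \<open>auto simp: S_def\<close>)
  thus False using k by simp
qed

section \<open>Trace codes and their syndromes\<close>

text \<open>The word with coefficient \<open>Tr(\<Sum>\<^sub>m \<lambda>\<^sub>m x\<^sup>-\<^sup>m)\<close> at the point \<open>x\<close>, where \<open>Tr z = z + z\<^sup>q\<close>
  is the trace to the base field. Inverse powers are written as \<open>x\<^sup>n\<^sup>-\<^sup>m\<close>.\<close>

definition trace_value :: "nat set \<Rightarrow> (nat \<Rightarrow> 'a alg_closure) \<Rightarrow> nat \<Rightarrow> 'a alg_closure" where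
  "trace_value M a j = (\<Sum>m\<in>M. a m * e j ^ (n - m) + (a m * e j ^ (n - m)) ^ q)"

definition trace_code :: "nat set \<Rightarrow> 'a poly set" where
  "trace_code M = {p \<in> words n. \<exists>a \<in> M \<rightarrow> F2. \<forall>j<n. to_ac (coeff p j) = trace_value M a j}"

lemma dvd_shift_iff:
  assumes "0 < m" "m < n" "0 < t" "t < n"
  shows "n dvd n - m + t \<longleftrightarrow> t = m"
proof -
  have "int n dvd int (n - m + t) \<longleftrightarrow> int n dvd int t - int m"
    using assms dvd_add_right_iff[of "int n" "int n" "int t - int m"] by (simp add: of_nat_diff algebra_simps)
  also have "\<dots> \<longleftrightarrow> t = m" using assms zdvd_imp_le[of "int n" "int t - int m"] zdvd_imp_le[of "int n" "int m - int t"]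
    by (cases t m rule: linorder_cases) (auto simp: dvd_diff_commute)
  finally show ?thesis by (simp only: int_dvd_int_iff)
qed

text \<open>Modulo \<open>n\<close> the number is \<open>t - m * q\<close>, which is nonzero and
  smaller than \<open>n\<close> in absolute value.\<close>

lemma not_dvd_Frobenius_shift:
  assumes "m \<le> n" "m * q \<noteq> t" "m * q < n" "t < n"
  shows "\<not> n dvd (n - m) * q + t"
proof
  assume "n dvd (n - m) * q + t"
  hence "int n dvd int ((n - m) * q + t)" by (simp only: int_dvd_int_iff)
  moreover have "(n - m) * q + m * q = n * q" using assms(1) by (simp flip: add_mult_distrib)
  hence "int ((n - m) * q) = int n * int q - int (m * q)" by (metis of_nat_add of_nat_mult add_diff_cancel_right')
  hence "int ((n - m) * q + t) = int n * int q + (int t - int (m * q))" by simp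
  ultimately have "int n dvd int n * int q + (int t - int (m * q))" by (simp only:)
  hence "int n dvd int t - int (m * q)" by (simp only: dvd_add_right_iff dvd_triv_left)
  moreover have "int t - int (m * q) \<noteq> 0" by (metis assms(2) eq_iff_diff_eq_0 of_nat_eq_iff)
  ultimately have "\<bar>int n\<bar> \<le> \<bar>int t - int (m * q)\<bar>" by (intro dvd_imp_le_int)
  thus False using assms(3,4) by linarith
qed

lemma less_n_if_mult_less: "m * q < n \<Longrightarrow> m < n"
  using q_gt_1 by (intro le_less_trans[of m "m * q"]) auto

text \<open>Summing over all points keeps only exponents divisible by \<open>n\<close>. The
  conjugate terms never qualify, the direct ones only for \<open>m = t\<close>, and the sign arises
  from \<open>n = -1\<close> in the field.\<close>

lemma syndrome_trace:
  assumes M: "finite M" "\<And>m. m \<in> M \<Longrightarrow> 0 < m \<and> m * q < n \<and> m * q \<noteq> t"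
    and t: "0 < t" "t < n"
    and p: "\<And>j. j < n \<Longrightarrow> to_ac (coeff p j) = trace_value M a j"
  shows "syndrome p t = (if t \<in> M then - a t else 0)"
proof -
  have less: "m < n" if "m \<in> M" for m
    using M(2)[OF that] less_n_if_mult_less by blast
  have "syndrome p t = (\<Sum>j<n. \<Sum>m\<in>M. a m * e j ^ (n - m + t) + a m ^ q * e j ^ ((n - m) * q + t))"
    unfolding syndrome_def
    by (intro sum.cong refl) (simp only: p trace_value_def lessThan_iff sum_distrib_right distrib_right
      power_add power_mult_distrib power_mult mult.assoc)
  also have "\<dots> = (\<Sum>m\<in>M. a m * (\<Sum>j<n. e j ^ (n - m + t)) + a m ^ q * (\<Sum>j<n. e j ^ ((n - m) * q + t)))"
    by (subst sum.swap) (simp add: sum_distrib_left sum.distrib)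
  also have "\<dots> = (\<Sum>m\<in>M. if m = t then - a t else 0)"
  proof (intro sum.cong refl)
    fix m assume m: "m \<in> M"
    have "n dvd n - m + t \<longleftrightarrow> t = m" using dvd_shift_iff[of m t] M(2)[OF m] less[OF m] t by auto
    moreover have "\<not> n dvd (n - m) * q + t"
      using not_dvd_Frobenius_shift[of m t] M(2)[OF m] less[OF m] t by auto
    ultimately show "a m * (\<Sum>j<n. e j ^ (n - m + t)) + a m ^ q * (\<Sum>j<n. e j ^ ((n - m) * q + t)) =
        (if m = t then - a t else 0)"
      unfolding sum_e_power by (auto simp: of_nat_n)
  qed
  also have "\<dots> = (if t \<in> M then - a t else 0)" using M(1) by simp
  finally show ?thesis .
qed

lemma subspace_trace_code: "poly_space.subspace (trace_code M)"
proof (rule poly_space.subspaceI)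
  have q0: "(0 :: 'a alg_closure) ^ q = 0" using q_gt_1 by (simp add: power_0_left)
  have "trace_value M (\<lambda>_. 0) j = 0" for j by (simp add: trace_value_def q0)
  moreover have "(\<lambda>_. 0) \<in> M \<rightarrow> F2" by (use q_gt_1 in \<open>auto simp: F2_def power_0_left\<close>)
  ultimately show "0 \<in> trace_code M" unfolding trace_code_def words_def by fastforce
next
  fix x y assume "x \<in> trace_code M" "y \<in> trace_code M"
  then obtain a b where ab: "a \<in> M \<rightarrow> F2" "b \<in> M \<rightarrow> F2" and xy: "x \<in> words n" "y \<in> words n"
    "\<And>j. j < n \<Longrightarrow> to_ac (coeff x j) = trace_value M a j" "\<And>j. j < n \<Longrightarrow> to_ac (coeff y j) = trace_value M b j"
    by (auto simp: trace_code_def)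
  have "(\<lambda>m. a m + b m) \<in> M \<rightarrow> F2" using ab by (auto simp: F2_def Pi_iff Frobenius_add)
  moreover have "trace_value M (\<lambda>m. a m + b m) j = trace_value M a j + trace_value M b j" for j
    by (simp add: trace_value_def Frobenius_add algebra_simps sum.distrib)
  ultimately show "x + y \<in> trace_code M" unfolding trace_code_def using xy
    by (auto simp: words_def intro!: bexI[of _ "\<lambda>m. a m + b m"])
next
  fix c x assume "x \<in> trace_code M"
  then obtain a where a: "a \<in> M \<rightarrow> F2" and x: "x \<in> words n"
    "\<And>j. j < n \<Longrightarrow> to_ac (coeff x j) = trace_value M a j"
    by (auto simp: trace_code_def)
  have "(\<lambda>m. to_ac c * a m) \<in> M \<rightarrow> F2"
    using a by (auto simp: F2_def Pi_iff power_mult_distrib power2_eq_square power_mult to_ac_power_q)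
  moreover have "trace_value M (\<lambda>m. to_ac c * a m) j = to_ac c * trace_value M a j" for j
    by (simp add: trace_value_def power_mult_distrib to_ac_power_q algebra_simps sum_distrib_left)
  ultimately show "smult c x \<in> trace_code M" unfolding trace_code_def using x
    by (auto simp: words_def intro!: bexI[of _ "\<lambda>m. to_ac c * a m"])
qed

text \<open>The \<open>q\<close>-th power swaps the two summands of each trace, so the values lie in
  the base field.\<close>

lemma exists_trace_word:
  assumes a: "a \<in> M \<rightarrow> F2"
  obtains p where "p \<in> words n" "\<And>j. j < n \<Longrightarrow> to_ac (coeff p j) = trace_value M a j"
proof -
  have "trace_value M a j \<in> range to_ac" if j: "j < n" for j
  proof (rule in_range_to_ac, unfold q)
    have sq: "((a m * e j ^ (n - m)) ^ q) ^ q = a m * e j ^ (n - m)" if "m \<in> M" for m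
    proof -
      have "((a m * e j ^ (n - m)) ^ q) ^ q = (a m * e j ^ (n - m)) ^ q\<^sup>2"
        by (simp only: power2_eq_square power_mult)
      also have "\<dots> = a m * e j ^ (n - m)"
        using a that by (auto simp: Pi_iff power_mult_distrib e_F2[OF j] F2_def)
      finally show ?thesis .
    qed
    show "trace_value M a j ^ q = trace_value M a j"
      unfolding trace_value_def Frobenius(1) by (intro sum.cong refl) (simp only: Frobenius_add sq add.commute)
  qed
  hence ac: "to_ac (of_ac (trace_value M a j)) = trace_value M a j" if "j < n" for j
    using that by (intro to_ac_of_ac)
  define p where "p = (\<Sum>j<n. monom (of_ac (trace_value M a j)) j)"
  show thesis by (rule that[of p]) (simp_all add: p_def words_def coeff_sum ac)
qed

text \<open>The syndromes at exponents in \<open>M\<close> recover the coefficients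
  \<open>a\<close>, which are arbitrary in \<open>F2\<close>.\<close>

lemma card_trace_code_ge:
  assumes M: "finite M" "\<And>m m'. m \<in> M \<Longrightarrow> m' \<in> M \<Longrightarrow> 0 < m \<and> m * q < n \<and> m * q \<noteq> m'"
  shows "q ^ (2 * card M) \<le> card (trace_code M)"
proof -
  have less: "m < n" if "m \<in> M" for m
    using M(2)[OF that that] less_n_if_mult_less by blast
  have fin: "finite (trace_code M)" by (rule finite_subset[of _ "words n"]) (auto simp: trace_code_def)
  have "M \<rightarrow>\<^sub>E F2 \<subseteq> (\<lambda>p. \<lambda>t\<in>M. - syndrome p t) ` trace_code M"
  proof
    fix a assume a: "a \<in> M \<rightarrow>\<^sub>E F2"
    hence a': "a \<in> M \<rightarrow> F2" by auto
    obtain p where p: "p \<in> words n" "\<And>j. j < n \<Longrightarrow> to_ac (coeff p j) = trace_value M a j"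
      using exists_trace_word[OF a'] by blast
    have "- syndrome p t = a t" if "t \<in> M" for t
      using that M less[OF that] by (subst syndrome_trace[OF M(1) _ _ _ p(2)]) auto
    hence "(\<lambda>t\<in>M. - syndrome p t) = a" using a by (auto simp: fun_eq_iff PiE_iff extensional_def)
    moreover have "p \<in> trace_code M" using p a' by (auto simp: trace_code_def)
    ultimately show "a \<in> (\<lambda>p. \<lambda>t\<in>M. - syndrome p t) ` trace_code M" by (metis (no_types) image_eqI)
  qed
  hence "card (M \<rightarrow>\<^sub>E F2) \<le> card (trace_code M)" by (rule surj_card_le[OF fin])
  thus ?thesis using M(1) by (simp add: card_funcsetE card_F2 power_mult)
qed

lemma trace_code_subset_zero_code:
  assumes M: "finite M" "\<And>m t. m \<in> M \<Longrightarrow> t \<in> J \<Longrightarrow> 0 < m \<and> m * q < n \<and> m * q \<noteq> t"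
    and J: "\<And>t. t \<in> J \<Longrightarrow> 0 < t \<and> t < n" and disj: "M \<inter> J = {}"
  shows "trace_code M \<subseteq> zero_code J"
proof
  fix p assume "p \<in> trace_code M"
  then obtain a where p: "p \<in> words n" "\<And>j. j < n \<Longrightarrow> to_ac (coeff p j) = trace_value M a j"
    by (auto simp: trace_code_def)
  have "syndrome p t = 0" if "t \<in> J" for t
    using that M(2) J disj by (subst syndrome_trace[OF M(1) _ _ _ p(2)]) auto
  thus "p \<in> zero_code J" using p by (auto simp: zero_code_def)
qed

text \<open>The syndromes at exponents in \<open>M\<close> are both zero and the negated
  coefficients of the trace word.\<close>

lemma zero_code_Int_trace_code:
  assumes M: "finite M" "\<And>m m'. m \<in> M \<Longrightarrow> m' \<in> M \<Longrightarrow> 0 < m \<and> m < n \<and> m * q < n \<and> m * q \<noteq> m'"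
    and sub: "M \<subseteq> J"
  shows "zero_code J \<inter> trace_code M = {0}"
proof (intro equalityI subsetI)
  fix p assume "p \<in> zero_code J \<inter> trace_code M"
  then obtain a where p: "p \<in> words n" "\<And>j. j < n \<Longrightarrow> to_ac (coeff p j) = trace_value M a j"
    and z: "\<And>t. t \<in> J \<Longrightarrow> syndrome p t = 0"
    by (auto simp: trace_code_def zero_code_def)
  have "- a t = 0" if t: "t \<in> M" for t
  proof -
    have "syndrome p t = - a t" using t M(2) by (subst syndrome_trace[OF M(1) _ _ _ p(2)]) auto
    thus ?thesis using z[of t] t sub by auto
  qed
  hence "trace_value M a j = 0" for j using q_gt_1 by (simp add: trace_value_def power_0_left)
  hence "coeff p j = 0" for j using p by (cases "j < n") (auto simp: words_def)
  thus "p \<in> {0}" by (simp add: poly_eq_iff)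
next
  fix p :: "'a poly" assume "p \<in> {0}"
  thus "p \<in> zero_code J \<inter> trace_code M"
    using poly_space.subspace_0[OF subspace_zero_code] poly_space.subspace_0[OF subspace_trace_code] by simp
qed

end

section \<open>The code with the required parameters\<close>

lemma exists_BCH_points:
  assumes "primepow q" "CARD('a::{field,finite}) = q" "n = q\<^sup>2 - 1"
  obtains e :: "nat \<Rightarrow> 'a::{field,finite} alg_closure" where "BCH_points n q e"
proof -
  have "of_nat n = (- 1 :: 'a alg_closure)"
    using of_nat_CARD_power2_minus_1[where 'a = 'a] assms by simp
  hence card: "card {x :: 'a alg_closure. x ^ n = 1} = n" by (intro card_roots_of_unity) simp
  moreover have "n > 0" using assms finite_field_card_gt_1[where 'a = 'a] one_less_power[of q 2] by simp
  ultimately have "finite {x :: 'a alg_closure. x ^ n = 1}" by (metis card.infinite less_irrefl)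
  then obtain e where "bij_betw e {0..<n} {x :: 'a alg_closure. x ^ n = 1}"
    using ex_bij_betw_nat_finite card by metis
  thus thesis using assms by (intro that[of e]) (unfold_locales, auto simp: lessThan_atLeast0)
qed

theorem theorem5p4:
  fixes q n i :: nat
  assumes "primepow q" and "q \<ge> 4"
    and "CARD('a::{field,finite}) = q"
    and "n = q\<^sup>2 - 1"
    and "1 \<le> i" and "i \<le> q - 3"
  shows "\<exists>C :: 'a poly vec set.
           convolutional_code C n (n - 2 * (q + i)) (2 * (q - 2 - i)) 1 \<and>
           free_distance C \<ge> 2 * q + 1"
proof -
  obtain e :: "nat \<Rightarrow> 'a alg_closure" where "BCH_points n q e"
    using exists_BCH_points assms by metis
  then interpret BCH_points n q e .
  \<comment> \<open>The exponent \<open>q\<close> is left out because the Frobenius map supplies it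
    from 1; this saves two dimensions. Together \<open>J0\<close> and \<open>J1\<close> are
    \<open>1, ..., 2 * q - 1\<close> without \<open>q\<close>.\<close>
  define J0 where "J0 = {1..q - 1} \<union> {q + 1..q + 1 + i}"
  define J1 where "J1 = {q + 2 + i..2 * q - 1}"
  define M where "M = {1..q - 2 - i}"
  \<comment> \<open>Each of the \<open>2 * (q - 1)\<close> exponents in
    \<open>J0 \<union> J1\<close> costs two dimensions, while \<open>g\<close> is twice the size of
    \<open>M\<close>.\<close>
  define m where "m = n - 4 * (q - 1)"
  define g where "g = 2 * (q - 2 - i)"
  have q_mult: "4 * q \<le> q\<^sup>2" using mult_le_mono1[OF assms(2), of q] by (simp add: power2_eq_square)
  have n_ge: "4 * (q - 1) \<le> n" "2 * q \<le> n" using q_mult assms(2,4) by linarith+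
  have cardJ0: "card J0 = q + i"
    unfolding J0_def using assms by (subst card_Un_disjoint) auto
  have cardJ1: "card J1 = q - 2 - i" using assms by (simp add: J1_def)
  have cardJ: "card (J0 \<union> J1) = 2 * (q - 1)"
    using assms by (subst card_Un_disjoint) (auto simp: cardJ0 cardJ1, auto simp: J0_def J1_def)
  have g_pos: "g > 0" using assms by (simp add: g_def)
  have mg: "m + g = n - 2 * (q + i)" "m + 2 * card (J0 \<union> J1) = n" "m + g + 2 * card J0 = n"
    using n_ge assms(2,5,6) by (auto simp: m_def g_def cardJ cardJ0)
  have fin: "finite J0" "finite J1" "finite M" by (simp_all add: J0_def J1_def M_def)
  \<comment> \<open>As \<open>i \<ge> 1\<close>, each \<open>k\<close> in \<open>M\<close> is at
    most \<open>q - 3\<close>, which keeps \<open>k * q\<close> below \<open>n\<close>. The only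
    multiple of \<open>q\<close> strictly between 0 and \<open>2 * q\<close> is \<open>q\<close>
    itself, which \<open>J0 \<union> J1\<close> omits.\<close>
  have M_mult: "0 < k \<and> k < n \<and> k * q < n \<and> k * q \<noteq> t" if k: "k \<in> M" and t: "t \<in> J0 \<union> J1" for k t
  proof -
    have "k * q \<le> (q - 3) * q" using k assms(5,6) by (intro mult_le_mono1) (auto simp: M_def)
    also have "\<dots> = q\<^sup>2 - 3 * q" by (simp add: diff_mult_distrib power2_eq_square)
    also have "\<dots> < n" using assms(2,4) q_mult by linarith
    finally have lt: "k * q < n" .
    have "\<not> q dvd t"
    proof
      assume "q dvd t"
      then obtain l where l: "t = q * l" by blast
      have "t < q * 2" "t > 0" "t \<noteq> q" using t assms(2,5,6) by (auto simp: J0_def J1_def)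
      hence "l < 2" "l > 0" "l \<noteq> 1" using l q_gt_1 by auto
      thus False by simp
    qed
    hence "k * q \<noteq> t" by auto
    thus ?thesis using k lt less_n_if_mult_less[OF lt] by (auto simp: M_def)
  qed
  have M_sub: "M \<subseteq> J0" by (auto simp: M_def J0_def)
  have sub1: "trace_code M \<subseteq> zero_code J1"
  proof (rule trace_code_subset_zero_code)
    show "0 < t \<and> t < n" if "t \<in> J1" for t using that n_ge q_gt_1 by (auto simp: J1_def)
  qed (use M_mult fin in \<open>auto simp: M_def J1_def\<close>)
  have inter: "zero_code J0 \<inter> trace_code M = {0}"
    by (rule zero_code_Int_trace_code) (use M_mult M_sub fin in blast)+
  obtain w R where wR: "unit_memory_words n m g (\<lambda>s. coeff (w s)) R"
    and w0: "\<And>s. s < m + g \<Longrightarrow> w s \<in> zero_code J0"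
    and w1: "\<And>s. s \<in> {..<m} \<union> {m + g..<m + 2 * g} \<Longrightarrow> w s \<in> zero_code J1"
  proof (rule exists_unit_memory_words[of "zero_code J0" "trace_code M" n "zero_code J1" m g])
    show "CARD('a) ^ m \<le> card (zero_code J0 \<inter> zero_code J1)"
      unfolding zero_code_Int q using mg fin by (intro card_zero_code_ge) auto
    show "CARD('a) ^ (m + g) \<le> card (zero_code J0)"
      unfolding q using mg fin by (intro card_zero_code_ge) auto
    have "q ^ (2 * card M) \<le> card (trace_code M)"
      using M_mult M_sub by (intro card_trace_code_ge fin) blast
    thus "CARD('a) ^ g \<le> card (trace_code M)" by (simp add: q g_def M_def)
  qed (use sub1 inter g_pos in \<open>auto simp: subspace_zero_code subspace_trace_code zero_code_subset\<close>)
  interpret unit_memory_words n m g "\<lambda>s. coeff (w s)" R by (rule wR)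
  have comb: "(\<Sum>s\<in>S. smult (a s) (w s)) \<in> zero_code J" if "\<And>s. s \<in> S \<Longrightarrow> w s \<in> zero_code J" for S J and a :: "nat \<Rightarrow> 'a"
    using that by (intro poly_space.subspace_sum poly_space.subspace_scale subspace_zero_code)
  have coeff_comb: "coeff (\<Sum>s\<in>S. smult (a s) (w s)) = (\<lambda>j. \<Sum>s\<in>S. a s * coeff (w s) j)" for S and a :: "nat \<Rightarrow> 'a"
    by (simp add: fun_eq_iff coeff_sum)
  have syn_q: "syndrome p q = 0" if "p \<in> zero_code J" "1 \<in> J" for p J
    using syndrome_Frobenius[of p 1] that q_gt_1 by (simp add: zero_code_def power_0_left)
  have syn_2q: "syndrome p (2 * q) = 0" if "p \<in> zero_code J" "2 \<in> J" for p J
    using syndrome_Frobenius[of p 2] that q_gt_1 by (simp add: zero_code_def power_0_left mult.commute)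
  have J_mem: "1 \<in> J0" "2 \<in> J0" using assms(2) by (auto simp: J0_def)
  \<comment> \<open>With \<open>q\<close> filled in, the zeros cover the consecutive exponents
    \<open>1, ..., q + 1 + i\<close>.\<close>
  have wt0: "Suc (q + 1 + i) \<le> word_weight n (coeff p)" if "p \<in> zero_code J0" "j < n" "coeff p j \<noteq> 0" for p j
  proof (rule word_weight_ge[where b = 1])
    fix t assume "1 \<le> t" "t < 1 + (q + 1 + i)"
    hence "t = q \<or> t \<in> J0" by (auto simp: J0_def)
    thus "syndrome p t = 0" using syn_q[OF that(1) J_mem(1)] that(1) by (auto simp: zero_code_def)
  qed (use that in auto)
  have wt1: "Suc (q - 2 - i) \<le> word_weight n (coeff p)" if "p \<in> zero_code J1" "j < n" "coeff p j \<noteq> 0" for p j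
    by (rule word_weight_ge[where b = "q + 2 + i"])
       (use that assms(2,5,6) in \<open>auto simp: zero_code_def J1_def\<close>)
  \<comment> \<open>With \<open>q\<close> and \<open>2 * q\<close> filled in, the zeros cover
    \<open>1, ..., 2 * q\<close>.\<close>
  have wt: "2 * q + 1 \<le> word_weight n (coeff p)"
    if p: "p \<in> zero_code J0" "p \<in> zero_code J1" and "j < n" "coeff p j \<noteq> 0" for p j
  proof -
    have "Suc (2 * q) \<le> word_weight n (coeff p)"
    proof (rule word_weight_ge[where b = 1])
      fix t assume "1 \<le> t" "t < 1 + 2 * q"
      hence "t = q \<or> t = 2 * q \<or> t \<in> J0 \<or> t \<in> J1" by (auto simp: J0_def J1_def)
      thus "syndrome p t = 0"
        using syn_q[OF p(1) J_mem(1)] syn_2q[OF p(1) J_mem(2)] p by (auto simp: zero_code_def)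
    qed (use that in auto)
    thus ?thesis by simp
  qed
  have "2 * q + 1 \<le> free_distance (generated_code encoder)"
  proof (rule free_distance_encoder[where d_first = "Suc (q + 1 + i)" and d_last = "Suc (q - 2 - i)"])
    \<comment> \<open>The two designed distances add up to exactly \<open>2 * q + 1\<close>.\<close>
    show "2 * q + 1 \<le> Suc (q + 1 + i) + Suc (q - 2 - i)" using assms(2,5,6) by simp
  next
    fix a :: "nat \<Rightarrow> 'a" and j assume "j < n" "(\<Sum>s<m + g. a s * coeff (w s) j) \<noteq> 0"
    thus "Suc (q + 1 + i) \<le> word_weight n (\<lambda>j. \<Sum>s<m + g. a s * coeff (w s) j)"
      unfolding coeff_comb[symmetric] by (intro wt0 comb w0) (auto simp: coeff_comb)
  next
    fix a :: "nat \<Rightarrow> 'a" and j assume "j < n" "(\<Sum>s\<in>{..<m} \<union> {m + g..<m + 2 * g}. a s * coeff (w s) j) \<noteq> 0"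
    thus "Suc (q - 2 - i) \<le> word_weight n (\<lambda>j. \<Sum>s\<in>{..<m} \<union> {m + g..<m + 2 * g}. a s * coeff (w s) j)"
      unfolding coeff_comb[symmetric] by (intro wt1 comb w1) (auto simp: coeff_comb)
  next
    fix a :: "nat \<Rightarrow> 'a" and j assume "j < n" "(\<Sum>s<m. a s * coeff (w s) j) \<noteq> 0"
    thus "2 * q + 1 \<le> word_weight n (\<lambda>j. \<Sum>s<m. a s * coeff (w s) j)"
      unfolding coeff_comb[symmetric] by (intro wt comb w0 w1) (auto simp: coeff_comb)
  qed
  thus ?thesis using convolutional_code_encoder mg(1) unfolding g_def[symmetric] by metis
qed

end
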